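(* Let $a\in(0,1/2)$. For any integer $p\ge 2$ and for Lebesgue-almost every $y\in[0,1]$, the sequence (the elements listed in increasing order) $$\{n\in\mathbb{N}:\ p^ny \bmod 1\in(0,n^{-a})\}$$ is pointwise universally $L^2$-good and ergodic.
   Context: $\mathbb{N}=\{1,2,3,\dots\}$. A measure-preserving system $(X,\mathcal{X},\mu,T)$ is a probability space $(X,\mathcal{X},\mu)$ with a measurable map $T\colon X\to X$ (not assumed invertible) such that $\mu(T^{-1}A)=\mu(A)$ for all $A\in\mathcal{X}$. $\mathcal{I}(T)=\{A\in\mathcal{X}: T^{-1}A=A \bmod \mu\}$ is the $\sigma$-algebra of invariant sets and $\mathbb{E}_\mu(f|\mathcal{I}(T))$ is the conditional expectation. A sequence of integers $(a_n)_{n\in\mathbb{N}}$ is pointwise universally $L^p$-good if for every measure-preserving system $(X,\mathcal{X},\mu,T)$ and $f\in L^p(\mu)$ the averages $\frac1N\sum_{n=1}^N f(T^{a_n}x)$ converge for $\mu$-almost every $x\in X$. It is ergodic if for every measure-preserving system and every $f\in L^2(\mu)$ the $L^2(\mu)$-limit of these averages exists and equals $\mathbb{E}_\mu(f|\mathcal{I}(T))$. An infinite subset of $\mathbb{N}$ is identified with the sequence enumerating it in increasing order; the claim includes that the set in question is infinite for almost every $y$. The exceptional null set of $y$ does not depend on the system $(X,\mathcal{X},\mu,T)$ or on $f$. *)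

theory Defs
  imports "HOL-Probability.Probability"
begin

locale measure_preserving_system = prob_space M
  for M :: "'x measure" and T :: "'x \<Rightarrow> 'x" +
  assumes measurable_map: "T \<in> measurable M M"
    and preserves_measure: "\<And>A. A \<in> sets M \<Longrightarrow> emeasure M (T -` A \<inter> space M) = emeasure M A"

definition invariant_sets :: "'x measure \<Rightarrow> ('x \<Rightarrow> 'x) \<Rightarrow> 'x set set" where
  "invariant_sets M T = {A \<in> sets M. sym_diff (T -` A \<inter> space M) A \<in> null_sets M}"

(* The library's conditional expectation takes a sub-sigma-algebra in the form of a measure, of
   which only the space and the measurable sets matter. The lemmas below show that the generation
   by sigma adds no sets. *)
definition invariant_algebra :: "'x measure \<Rightarrow> ('x \<Rightarrow> 'x) \<Rightarrow> 'x measure" where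
  "invariant_algebra M T = sigma (space M) (invariant_sets M T)"

lemma (in measure_preserving_system) invariant_sets_iff_AE:
  "A \<in> invariant_sets M T \<longleftrightarrow> A \<in> sets M \<and> (AE x in M. T x \<in> A \<longleftrightarrow> x \<in> A)"
proof (cases "A \<in> sets M")
  case True
  have "T -` A \<inter> space M \<in> sets M"
    using measurable_map True by (rule measurable_sets)
  then have "sym_diff (T -` A \<inter> space M) A \<in> sets M"
    using True by auto
  then have "sym_diff (T -` A \<inter> space M) A \<in> null_sets M
      \<longleftrightarrow> (AE x in M. x \<notin> sym_diff (T -` A \<inter> space M) A)"
    by (rule AE_iff_null_sets)
  also have "\<dots> \<longleftrightarrow> (AE x in M. T x \<in> A \<longleftrightarrow> x \<in> A)"
    by (rule AE_cong) auto
  finally show ?thesis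
    using True by (simp add: invariant_sets_def)
qed (simp add: invariant_sets_def)

lemma (in measure_preserving_system) sigma_algebra_invariant_sets:
  "sigma_algebra (space M) (invariant_sets M T)"
  unfolding sigma_algebra_iff2
proof (intro conjI ballI allI impI)
  show "invariant_sets M T \<subseteq> Pow (space M)"
    using sets.sets_into_space by (auto simp: invariant_sets_def)
  show "{} \<in> invariant_sets M T"
    by (simp add: invariant_sets_def)
next
  fix A assume "A \<in> invariant_sets M T"
  then have A: "A \<in> sets M" "AE x in M. T x \<in> A \<longleftrightarrow> x \<in> A"
    by (auto simp: invariant_sets_iff_AE)
  have "AE x in M. T x \<in> space M"
    using measurable_space[OF measurable_map] by auto
  then have "AE x in M. T x \<in> space M - A \<longleftrightarrow> x \<in> space M - A"
    using A(2) AE_space by eventually_elim auto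
  then show "space M - A \<in> invariant_sets M T"
    using A(1) by (auto simp: invariant_sets_iff_AE)
next
  fix B :: "nat \<Rightarrow> 'x set" assume "range B \<subseteq> invariant_sets M T"
  then have B: "B i \<in> sets M" "AE x in M. T x \<in> B i \<longleftrightarrow> x \<in> B i" for i
    using invariant_sets_iff_AE[of "B i"] by blast+
  have "AE x in M. \<forall>i. T x \<in> B i \<longleftrightarrow> x \<in> B i"
    using B(2) by (simp add: AE_all_countable)
  then have "AE x in M. T x \<in> (\<Union>i. B i) \<longleftrightarrow> x \<in> (\<Union>i. B i)"
    by eventually_elim auto
  then show "(\<Union>i. B i) \<in> invariant_sets M T"
    using B(1) by (auto simp: invariant_sets_iff_AE)
qed

lemma (in measure_preserving_system) sets_invariant_algebra:
  "sets (invariant_algebra M T) = invariant_sets M T"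
  unfolding invariant_algebra_def
  by (rule sigma_algebra.sets_measure_of_eq[OF sigma_algebra_invariant_sets])

lemma (in measure_preserving_system) subalgebra_invariant_algebra:
  "subalgebra M (invariant_algebra M T)"
proof -
  have "space (invariant_algebra M T) = space M"
    using sets.sets_into_space by (auto simp: invariant_algebra_def invariant_sets_def space_measure_of_conv)
  then show ?thesis
    by (auto simp: subalgebra_def sets_invariant_algebra invariant_sets_def)
qed

definition in_Lp :: "'x measure \<Rightarrow> real \<Rightarrow> ('x \<Rightarrow> complex) \<Rightarrow> bool" where
  "in_Lp M q f \<longleftrightarrow> f \<in> borel_measurable M \<and> integrable M (\<lambda>x. norm (f x) powr q)"

definition complex_cond_exp :: "'x measure \<Rightarrow> 'x measure \<Rightarrow> ('x \<Rightarrow> complex) \<Rightarrow> 'x \<Rightarrow> complex" where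
  "complex_cond_exp M F f x =
     Complex (real_cond_exp M F (\<lambda>x. Re (f x)) x) (real_cond_exp M F (\<lambda>x. Im (f x)) x)"

(* Sequences are indexed from 0, so the average over the first N terms runs over n < N. *)
definition ergodic_average :: "('x \<Rightarrow> 'x) \<Rightarrow> (nat \<Rightarrow> nat) \<Rightarrow> ('x \<Rightarrow> complex) \<Rightarrow> nat \<Rightarrow> 'x \<Rightarrow> complex" where
  "ergodic_average T s f N x = (\<Sum>n<N. f ((T ^^ s n) x)) / of_nat N"

(* A formula cannot quantify over types, so the next two notions carry the type of the points of
   the systems as a parameter. Systems on nat => complex are already universal: any f on any
   system factors through the shift on this space via x |-> (f (T^n x))_n. Hence an almost-every
   statement for that type, together with the transfer to an arbitrary type at each single point,
   expresses a null set that depends neither on the system nor on the type of its points. *)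
definition pointwise_universally_good :: "'x itself \<Rightarrow> real \<Rightarrow> (nat \<Rightarrow> nat) \<Rightarrow> bool" where
  "pointwise_universally_good _ q s \<longleftrightarrow>
     (\<forall>(M :: 'x measure) T f. measure_preserving_system M T \<and> in_Lp M q f \<longrightarrow>
        (AE x in M. convergent (\<lambda>N. ergodic_average T s f N x)))"

(* The squared distance in L^2 is a Lebesgue integral with values in [0, \<infinity>], so that a
   non-integrable integrand cannot count as 0. *)
definition ergodic_sequence :: "'x itself \<Rightarrow> (nat \<Rightarrow> nat) \<Rightarrow> bool" where
  "ergodic_sequence _ s \<longleftrightarrow>
     (\<forall>(M :: 'x measure) T f. measure_preserving_system M T \<and> in_Lp M 2 f \<longrightarrow>
        (\<lambda>N. \<integral>\<^sup>+x. ennreal ((norm (ergodic_average T s f N x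
             - complex_cond_exp M (invariant_algebra M T) f x))\<^sup>2) \<partial>M) \<longlonglongrightarrow> 0)"

definition shrinking_target_set :: "real \<Rightarrow> nat \<Rightarrow> real \<Rightarrow> nat set" where
  "shrinking_target_set a p y = {n. 1 \<le> n \<and> frac (real p ^ n * y) \<in> {0<..<real n powr (- a)}}"

definition good_and_ergodic_set :: "'x itself \<Rightarrow> nat set \<Rightarrow> bool" where
  "good_and_ergodic_set t S \<longleftrightarrow>
     infinite S \<and> pointwise_universally_good t 2 (enumerate S) \<and> ergodic_sequence t (enumerate S)"

end

theory Submission
  imports Defs "HOL-Real_Asymp.Real_Asymp"
begin

text \<open>
  Let \<open>X n\<close> be the indicator of the event that \<open>n\<close> belongs to the set, \<open>w n = n powr (- a)\<close> its mean
  and \<open>c n = X n - w n\<close>. Expanding the square and using that \<open>T\<close> is an isometry of \<open>L\<^sup>2\<close>,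
  \<open>\<parallel>\<Sum>n<N. c n f(T\<^sup>n x)\<parallel>\<^sup>2\<close> is at most \<open>\<parallel>f\<parallel>\<^sup>2\<close> times the sum over \<open>h\<close> of the absolute autocorrelations
  \<open>\<bar>\<Sum>n. c n c (n + h)\<bar>\<close>, a quantity that depends on \<open>y\<close> only. Digits of \<open>y\<close> at distance \<open>K\<close> decorrelate up
  to an error \<open>p\<^sup>-\<^sup>K\<close>, so the mean over \<open>y\<close> of the squared autocorrelation is about \<open>N powr (1 - 2a)\<close>
  and that of the whole sum about \<open>N powr (3/2 - a)\<close>, up to small powers of \<open>N\<close>. For \<open>a < 1/2\<close> this is
  smaller by a power of \<open>N\<close> than \<open>N powr (2 - 2a)\<close>, the order of the square of the number of elements
  below \<open>N\<close>. Along a polynomially growing sequence of \<open>N\<close> the quotients are therefore summable for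
  almost every \<open>y\<close>, and averages with the weights \<open>X n\<close> and with the weights \<open>w n\<close> have the same limit;
  monotonicity for \<open>f \<ge> 0\<close> fills the gaps between the chosen \<open>N\<close>, and the averages with the weights
  \<open>w n\<close> are handled by Birkhoff's theorem and Abel summation.
\<close>

text \<open>By monotone convergence the integral of the series is the series of the integrals, hence
  finite, so the series is finite almost everywhere. This serves once for the digit variable
  \<open>y\<close> and once for the points of a system.\<close>

lemma AE_summable_of_nn_integral_le:
  fixes f :: "nat \<Rightarrow> 'a \<Rightarrow> real"
  assumes [measurable]: "\<And>k. f k \<in> borel_measurable M" and nn: "\<And>k x. 0 \<le> f k x"
    and le: "\<And>k. (\<integral>\<^sup>+x. ennreal (f k x) \<partial>M) \<le> ennreal (b k)" and b: "summable b" "\<And>k. 0 \<le> b k"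
  shows "AE x in M. summable (\<lambda>k. f k x)"
proof -
  have "(\<integral>\<^sup>+x. (\<Sum>k. ennreal (f k x)) \<partial>M) = (\<Sum>k. \<integral>\<^sup>+x. ennreal (f k x) \<partial>M)"
    by (rule nn_integral_suminf) measurable
  also have "\<dots> \<le> (\<Sum>k. ennreal (b k))" by (intro suminf_le le) auto
  also have "\<dots> < \<infinity>" using ennreal_suminf_neq_top[OF b] by (simp add: top.not_eq_extremum)
  finally have "(\<integral>\<^sup>+x. (\<Sum>k. ennreal (f k x)) \<partial>M) \<noteq> \<infinity>" by simp
  then have "AE x in M. (\<Sum>k. ennreal (f k x)) \<noteq> \<infinity>"
    by (intro nn_integral_noteq_infinite) measurable
  then show ?thesis
  proof eventually_elim
    case (elim x)
    then show ?case using nn by (intro summable_suminf_not_top) auto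
  qed
qed

section \<open>The pointwise ergodic theorem\<close>

context measure_preserving_system
begin

sublocale inv: finite_measure_subalgebra M "invariant_algebra M T"
  by unfold_locales (rule subalgebra_invariant_algebra)

section \<open>Iterates of the map and invariant functions\<close>

lemma distr_map: "distr M M T = M"
proof (rule measure_eqI)
  fix A assume "A \<in> sets (distr M M T)"
  then show "emeasure (distr M M T) A = emeasure M A"
    using measurable_map preserves_measure by (simp add: emeasure_distr)
qed simp

lemma measurable_funpow [measurable]: "T ^^ n \<in> measurable M M"
  using measurable_map by (induction n) (auto simp: comp_def)

lemma measurable_funpow_apply:
  "g \<in> measurable M N \<Longrightarrow> (\<lambda>x. g ((T ^^ n) x)) \<in> measurable M N"
  using measurable_compose[OF measurable_funpow] .

lemma distr_funpow: "distr M M (T ^^ n) = M"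
proof (induction n)
  case 0
  show ?case using distr_id[of M] by (simp add: id_def)
next
  case (Suc n)
  have "distr M M (T ^^ Suc n) = distr (distr M M (T ^^ n)) M T"
    using distr_distr[OF measurable_map measurable_funpow] by simp
  then show ?case unfolding Suc distr_map .
qed

lemma
  fixes g :: "'x \<Rightarrow> 'b :: {banach, second_countable_topology}"
  assumes "g \<in> borel_measurable M"
  shows integral_funpow: "(\<integral>x. g ((T ^^ n) x) \<partial>M) = (\<integral>x. g x \<partial>M)"
    and integrable_funpow_iff: "integrable M (\<lambda>x. g ((T ^^ n) x)) \<longleftrightarrow> integrable M g"
  using assms integral_distr[of "T ^^ n" M M g] integrable_distr_eq[of "T ^^ n" M M g]
  by (simp_all add: distr_funpow)

lemma AE_funpow:
  assumes "AE x in M. P x"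
  shows "AE x in M. P ((T ^^ n) x)"
  by (rule AE_distrD[OF measurable_funpow]) (simp only: distr_funpow assms)

text \<open>Invariance of the level sets holds up to null sets that depend on the level. The
  rational levels are countable in number and separate distinct reals, so a single null set serves
  for the function itself.\<close>

lemma borel_measurable_invariant_algebra_iff:
  fixes h :: "'x \<Rightarrow> real"
  shows "h \<in> borel_measurable (invariant_algebra M T) \<longleftrightarrow>
    h \<in> borel_measurable M \<and> (AE x in M. h (T x) = h x)"
proof
  assume h: "h \<in> borel_measurable (invariant_algebra M T)"
  have sp: "space (invariant_algebra M T) = space M"
    using subalgebra_invariant_algebra by (simp add: subalgebra_def)
  have hM: "h \<in> borel_measurable M"
    by (rule measurable_from_subalg[OF subalgebra_invariant_algebra h])
  have TM: "T x \<in> space M" if "x \<in> space M" for x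
    using measurable_space[OF measurable_map that] .
  have "AE x in M. h (T x) < of_rat q \<longleftrightarrow> h x < of_rat q" for q
  proof -
    have "{x \<in> space M. h x < of_rat q} \<in> sets (invariant_algebra M T)"
      using h unfolding sp[symmetric] by measurable
    then have "AE x in M. T x \<in> {x \<in> space M. h x < of_rat q} \<longleftrightarrow> x \<in> {x \<in> space M. h x < of_rat q}"
      by (simp only: sets_invariant_algebra invariant_sets_iff_AE)
    then show ?thesis using AE_space by eventually_elim (use TM in auto)
  qed
  then have "AE x in M. \<forall>q. h (T x) < of_rat q \<longleftrightarrow> h x < of_rat q"
    by (simp add: AE_all_countable)
  then have "AE x in M. h (T x) = h x"
  proof eventually_elim
    case (elim x)
    show ?case
    proof (rule ccontr)
      assume "h (T x) \<noteq> h x"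
      then consider "h (T x) < h x" | "h x < h (T x)" by linarith
      then show False
        using elim of_rat_dense by cases (metis less_asym)+
    qed
  qed
  with hM show "h \<in> borel_measurable M \<and> (AE x in M. h (T x) = h x)" ..
next
  assume h: "h \<in> borel_measurable M \<and> (AE x in M. h (T x) = h x)"
  have sp: "space (invariant_algebra M T) = space M"
    using subalgebra_invariant_algebra by (simp add: subalgebra_def)
  show "h \<in> borel_measurable (invariant_algebra M T)"
  proof (rule measurableI)
    fix B :: "real set" assume B: "B \<in> sets borel"
    have "AE x in M. T x \<in> h -` B \<inter> space M \<longleftrightarrow> x \<in> h -` B \<inter> space M"
      using h[THEN conjunct2] AE_space
      by eventually_elim (use measurable_space[OF measurable_map] in auto)
    then show "h -` B \<inter> space (invariant_algebra M T) \<in> sets (invariant_algebra M T)"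
      using measurable_sets[OF conjunct1[OF h] B]
      by (simp add: sp sets_invariant_algebra invariant_sets_iff_AE)
  qed auto
qed

text \<open>Preimages of null sets under the iterates are null, so the one-step identity holds along
  the whole orbit off a single null set.\<close>

lemma AE_cond_exp_invariant:
  "AE x in M. \<forall>n. real_cond_exp M (invariant_algebra M T) f ((T ^^ n) x)
     = real_cond_exp M (invariant_algebra M T) f x"
proof -
  let ?E = "real_cond_exp M (invariant_algebra M T) f"
  have "AE x in M. ?E (T x) = ?E x"
    using borel_measurable_invariant_algebra_iff[of ?E] borel_measurable_cond_exp by blast
  then have "AE x in M. ?E (T ((T ^^ n) x)) = ?E ((T ^^ n) x)" for n
    by (rule AE_funpow)
  then have "AE x in M. \<forall>n. ?E ((T ^^ Suc n) x) = ?E ((T ^^ n) x)"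
    by (simp add: AE_all_countable)
  then show ?thesis
  proof eventually_elim
    case (elim x)
    show ?case
    proof
      fix n show "?E ((T ^^ n) x) = ?E x"
        using elim by (induction n) auto
    qed
  qed
qed

text \<open>\<^term>\<open>maximal_sum g n x\<close> is the maximum of the Birkhoff sums of \<^term>\<open>g\<close> at \<^term>\<open>x\<close>
  of lengths \<open>0, \<dots>, n\<close>.\<close>

primrec maximal_sum :: "('x \<Rightarrow> real) \<Rightarrow> nat \<Rightarrow> 'x \<Rightarrow> real" where
  "maximal_sum g 0 x = 0"
| "maximal_sum g (Suc n) x = max 0 (g x + maximal_sum g n (T x))"

lemma maximal_sum_nonneg: "0 \<le> maximal_sum g n x"
  by (cases n) auto

lemma maximal_sum_Suc_ge: "maximal_sum g n x \<le> maximal_sum g (Suc n) x"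
proof (induction n arbitrary: x)
  case (Suc n)
  show ?case using Suc[of "T x"] by simp
qed simp

lemma maximal_sum_mono: "m \<le> n \<Longrightarrow> maximal_sum g m x \<le> maximal_sum g n x"
  using maximal_sum_Suc_ge by (rule lift_Suc_mono_le[where f = "\<lambda>n. maximal_sum g n x"])

lemma Birkhoff_sum_le_maximal_sum: "(\<Sum>i<n. g ((T ^^ i) x)) \<le> maximal_sum g n x"
proof (induction n arbitrary: x)
  case (Suc n)
  have "(\<Sum>i<Suc n. g ((T ^^ i) x)) = g x + (\<Sum>i<n. g ((T ^^ i) (T x)))"
    by (simp add: sum.lessThan_Suc_shift funpow_swap1 del: sum.lessThan_Suc)
  also have "\<dots> \<le> g x + maximal_sum g n (T x)"
    using Suc by simp
  finally show ?case by simp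
qed simp

lemma integrable_maximal_sum:
  assumes "integrable M g"
  shows "integrable M (maximal_sum g n)"
proof (induction n)
  case (Suc n)
  have "integrable M (\<lambda>x. maximal_sum g n (T x))"
    using Suc integrable_funpow_iff[of "maximal_sum g n" 1] by auto
  then show ?case using assms by (auto intro!: integrable_max)
qed simp

text \<open>Garsia's argument on the invariant set \<open>A\<close> where the maximal sums are
  unbounded. The difference \<open>maximal_sum g (Suc n) x - maximal_sum g n (T x)\<close> is
  \<open>max (- maximal_sum g n (T x)) (g x)\<close>, which on \<open>A\<close> equals
  \<open>g x\<close> for large \<open>n\<close>. Its integral over \<open>A\<close> is nonnegative,
  because \<open>T\<close> preserves the measure and maximal sums increase with \<open>n\<close>. In
  the limit \<open>g\<close> has nonnegative integral over \<open>A\<close>, so \<open>neg\<close>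
  forces \<open>A\<close> to be null.\<close>

lemma AE_Birkhoff_sums_bounded:
  fixes g :: "'x \<Rightarrow> real"
  assumes g: "integrable M g"
    and neg: "\<And>A. A \<in> invariant_sets M T \<Longrightarrow> measure M A > 0 \<Longrightarrow> (\<integral>x\<in>A. g x \<partial>M) < 0"
  shows "AE x in M. \<exists>C. \<forall>n. (\<Sum>i<n. g ((T ^^ i) x)) \<le> C"
proof -
  let ?F = "maximal_sum g"
  note [measurable] = measurable_map
  have F[measurable]: "integrable M (?F n)" "?F n \<in> borel_measurable M" for n
    using integrable_maximal_sum[OF g] by auto
  have FT: "integrable M (\<lambda>x. ?F n (T x))" for n
    using F[of n] integrable_funpow_iff[of "?F n" 1] by simp
  define A where "A = {x \<in> space M. \<forall>C::nat. \<exists>n. real C < ?F n x}"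
  have A[measurable]: "A \<in> sets M" unfolding A_def by measurable
  have TA: "T x \<in> A \<longleftrightarrow> x \<in> A" if x: "x \<in> space M" for x
  proof
    assume "T x \<in> A"
    then have a: "\<exists>n. real C < ?F n (T x)" for C by (simp add: A_def)
    have "\<exists>n. real C < ?F n x" for C
    proof -
      obtain C' where "real C - g x < real C'" using reals_Archimedean2 by blast
      moreover obtain n where "real C' < ?F n (T x)" using a by blast
      ultimately have "real C < ?F (Suc n) x" by simp
      then show ?thesis ..
    qed
    then show "x \<in> A" using x by (simp add: A_def)
  next
    assume "x \<in> A"
    then have a: "\<exists>n. real C < ?F n x" for C by (simp add: A_def)
    have "\<exists>n. real C < ?F n (T x)" for C
    proof -
      obtain C' where C': "real C + g x < real C'" using reals_Archimedean2 by blast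
      obtain n where n: "real C' < ?F n x" using a by blast
      \<comment> \<open>\<open>n\<close> is not 0, since \<open>maximal_sum g 0 x = 0\<close> cannot
        exceed \<open>real C'\<close>.\<close>
      then obtain m where "n = Suc m" by (cases n) auto
      with n C' have "real C < ?F m (T x)" by (simp add: less_max_iff_disj)
      then show ?thesis ..
    qed
    then show "T x \<in> A" using x measurable_space[OF measurable_map] by (simp add: A_def)
  qed
  have inv: "A \<in> invariant_sets M T"
    unfolding invariant_sets_iff_AE using A TA by auto
  let ?h = "\<lambda>n x. indicator A x * max (- ?F n (T x)) (g x)"
  have "(\<lambda>n. \<integral>x. ?h n x \<partial>M) \<longlonglongrightarrow> (\<integral>x. indicator A x * g x \<partial>M)"
  proof (rule integral_dominated_convergence)
    show "integrable M (\<lambda>x. \<bar>g x\<bar>)" using g by simp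
    show "AE x in M. norm (?h n x) \<le> \<bar>g x\<bar>" for n
    proof (rule AE_I2)
      fix x show "norm (?h n x) \<le> \<bar>g x\<bar>"
        using maximal_sum_nonneg[of g n "T x"] by (auto simp: indicator_def)
    qed
    show "AE x in M. (\<lambda>n. ?h n x) \<longlonglongrightarrow> indicator A x * g x"
    proof (rule AE_I2)
      fix x assume x: "x \<in> space M"
      show "(\<lambda>n. ?h n x) \<longlonglongrightarrow> indicator A x * g x"
      proof (cases "x \<in> A")
        case True
        obtain C :: nat where C: "- g x < real C" using reals_Archimedean2 by blast
        have "T x \<in> A" using True TA x by blast
        then obtain m where m: "real C < ?F m (T x)" unfolding A_def by blast
        have "?h n x = indicator A x * g x" if "n \<ge> m" for n
          using maximal_sum_mono[OF that, of g "T x"] m C True by simp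
        then show ?thesis
          by (intro tendsto_eventually) (auto simp: eventually_sequentially)
      qed simp
    qed
  qed (use g F in measurable)
  moreover have "0 \<le> (\<integral>x. ?h n x \<partial>M)" for n
  proof -
    have h: "?h n x = indicator A x * ?F (Suc n) x - indicator A x * ?F n (T x)" for x
      by (simp add: algebra_simps indicator_def max_def)
    have iA: "integrable M (\<lambda>x. indicator A x * ?F k x)" for k
      using integrable_mult_indicator[OF A F(1)[of k]] by simp
    have iAT: "integrable M (\<lambda>x. indicator A x * ?F k (T x))" for k
      using integrable_mult_indicator[OF A FT[of k]] by simp
    \<comment> \<open>Invariance of \<open>A\<close> makes the integrand a function of
      \<open>T x\<close>, so that measure preservation applies.\<close>
    have "(\<integral>x. indicator A x * ?F n (T x) \<partial>M) = (\<integral>x. indicator A (T x) * ?F n (T x) \<partial>M)"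
      using TA by (intro Bochner_Integration.integral_cong) (auto simp: indicator_def)
    also have "\<dots> = (\<integral>x. indicator A x * ?F n x \<partial>M)"
      using integral_funpow[of "\<lambda>x. indicator A x * ?F n x" 1] by simp
    finally have "(\<integral>x. ?h n x \<partial>M)
        = (\<integral>x. indicator A x * ?F (Suc n) x \<partial>M) - (\<integral>x. indicator A x * ?F n x \<partial>M)"
      unfolding h using iA iAT by (simp del: maximal_sum.simps)
    also have "\<dots> \<ge> 0"
      using iA maximal_sum_Suc_ge
      by (auto intro!: integral_mono mult_left_mono simp del: maximal_sum.simps)
    finally show ?thesis .
  qed
  ultimately have "0 \<le> (\<integral>x\<in>A. g x \<partial>M)"
    by (auto intro: LIMSEQ_le_const simp: set_lebesgue_integral_def)
  then have "\<not> measure M A > 0" using neg[OF inv] by auto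
  then have "measure M A = 0" by (simp add: zero_less_measure_iff)
  then have "emeasure M A = 0" by (simp add: emeasure_eq_measure)
  then have "AE x in M. x \<notin> A" using A by (intro AE_not_in) (auto simp: null_sets_def)
  then show ?thesis using AE_space
  proof eventually_elim
    case (elim x)
    then obtain C :: nat where "\<not> (\<exists>n. real C < ?F n x)" unfolding A_def by blast
    then have "(\<Sum>i<n. g ((T ^^ i) x)) \<le> C" for n
      using Birkhoff_sum_le_maximal_sum[of g x n] by (meson not_le order.strict_trans2)
    then show ?case by blast
  qed
qed

text \<open>Subtracting the conditional expectation and \<open>e / 2\<close> leaves a function with
  negative integral over every invariant set of positive measure, so its Birkhoff sums are bounded
  above. The conditional expectation is constant along orbits, and after division by
  \<open>n\<close> the bound drops below \<open>e / 2\<close>.\<close>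

lemma AE_Birkhoff_eventually_le:
  assumes f: "integrable M f" and e: "0 < e"
  shows "AE x in M. \<forall>\<^sub>F n in sequentially.
    (\<Sum>i<n. f ((T ^^ i) x)) / n \<le> real_cond_exp M (invariant_algebra M T) f x + e"
proof -
  let ?E = "real_cond_exp M (invariant_algebra M T) f"
  have E: "integrable M ?E" using inv.real_cond_exp_int(1)[OF f] .
  define g where "g x = f x - ?E x - e / 2" for x
  have g: "integrable M g" unfolding g_def using f E by simp
  have "AE x in M. \<exists>C. \<forall>n. (\<Sum>i<n. g ((T ^^ i) x)) \<le> C"
  proof (rule AE_Birkhoff_sums_bounded[OF g])
    fix A assume A: "A \<in> invariant_sets M T" and pos: "measure M A > 0"
    have AM[measurable]: "A \<in> sets M" using A by (simp add: invariant_sets_def)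
    have i: "set_integrable M A f" "set_integrable M A ?E"
      using integrable_mult_indicator[OF AM f] integrable_mult_indicator[OF AM E]
      by (auto simp: set_integrable_def)
    have c: "set_integrable M A (\<lambda>x. e / 2)"
      unfolding set_integrable_def by (rule integrable_mult_indicator[OF AM]) simp
    have "(\<integral>x\<in>A. g x \<partial>M) = (\<integral>x\<in>A. f x \<partial>M) - (\<integral>x\<in>A. ?E x \<partial>M) - (\<integral>x\<in>A. e / 2 \<partial>M)"
      unfolding g_def using i c by simp
    also have "(\<integral>x\<in>A. f x \<partial>M) = (\<integral>x\<in>A. ?E x \<partial>M)"
      using inv.real_cond_exp_intA[OF f] A by (simp add: sets_invariant_algebra)
    also have "(\<integral>x\<in>A. e / 2 \<partial>M) = measure M A * (e / 2)"
      by (simp add: set_lebesgue_integral_def)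
    finally show "(\<integral>x\<in>A. g x \<partial>M) < 0" using pos e by (simp add: mult_pos_pos)
  qed
  then show ?thesis using AE_cond_exp_invariant[of f]
  proof eventually_elim
    case (elim x)
    then obtain C where C: "\<And>n. (\<Sum>i<n. g ((T ^^ i) x)) \<le> C" by blast
    have s: "(\<Sum>i<n. g ((T ^^ i) x)) = (\<Sum>i<n. f ((T ^^ i) x)) - n * (?E x + e / 2)" for n
      using elim(2) by (simp add: g_def sum_subtractf algebra_simps)
    have "(\<lambda>n. C / real n) \<longlonglongrightarrow> 0" by (rule lim_const_over_n)
    then have "\<forall>\<^sub>F n in sequentially. C / real n < e / 2"
      using e by (intro order_tendstoD) auto
    then show ?case using eventually_gt_at_top[of 0]
    proof eventually_elim
      case (elim n)
      have "(\<Sum>i<n. f ((T ^^ i) x)) / n \<le> (C + n * (?E x + e / 2)) / n"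
        using C[of n] unfolding s by (intro divide_right_mono) auto
      also have "\<dots> = C / n + (?E x + e / 2)" using elim by (simp add: field_simps)
      finally show ?case using elim(1) by linarith
    qed
  qed
qed

text \<open>The one-sided estimate for \<open>f\<close> bounds the averages from above and the one
  for \<open>- f\<close> from below. The errors \<open>1 / Suc k\<close> keep the exceptional set a
  countable union of null sets.\<close>

theorem AE_Birkhoff:
  assumes f: "integrable M f"
  shows "AE x in M. (\<lambda>n. (\<Sum>i<n. f ((T ^^ i) x)) / n)
    \<longlonglongrightarrow> real_cond_exp M (invariant_algebra M T) f x"
proof -
  let ?E = "real_cond_exp M (invariant_algebra M T)"
  have m: "integrable M (\<lambda>x. - f x)" using f by simp
  have neg: "AE x in M. ?E (\<lambda>x. - f x) x = - ?E f x"
    using inv.real_cond_exp_cmult[OF f, of "-1"] by simp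
  have "AE x in M. \<forall>k::nat. \<forall>\<^sub>F n in sequentially.
      (\<Sum>i<n. f ((T ^^ i) x)) / n \<le> ?E f x + 1 / Suc k"
    by (simp only: AE_all_countable, intro allI AE_Birkhoff_eventually_le[OF f]) simp
  moreover have "AE x in M. \<forall>k::nat. \<forall>\<^sub>F n in sequentially.
      (\<Sum>i<n. - f ((T ^^ i) x)) / n \<le> ?E (\<lambda>x. - f x) x + 1 / Suc k"
    by (simp only: AE_all_countable, intro allI AE_Birkhoff_eventually_le[OF m]) simp
  ultimately show ?thesis using neg
  proof eventually_elim
    case (elim x)
    show ?case
    proof (rule LIMSEQ_I)
      fix r :: real assume "0 < r"
      then obtain k :: nat where k: "1 / Suc k < r" using nat_approx_posE by blast
      have "\<forall>\<^sub>F n in sequentially. norm ((\<Sum>i<n. f ((T ^^ i) x)) / n - ?E f x) < r"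
        using elim(1)[rule_format, of k] elim(2)[rule_format, of k]
      proof eventually_elim
        case (elim n)
        then show ?case using k \<open>?E (\<lambda>x. - f x) x = - ?E f x\<close>
          unfolding sum_negf minus_divide_left[symmetric] real_norm_def by linarith
      qed
      then show "\<exists>no. \<forall>n\<ge>no. norm ((\<Sum>i<n. f ((T ^^ i) x)) / n - ?E f x) < r"
        by (simp add: eventually_sequentially)
    qed
  qed
qed

end

section \<open>Decorrelation of the digit process\<close>

text \<open>The half-open interval splits exactly into the cells on which
  \<open>\<lfloor>q * y\<rfloor>\<close> takes the values \<open>0, ..., q - 1\<close>; the endpoint
  1 would add a further value.\<close>

definition unit_interval :: "real measure" where
  "unit_interval = restrict_space lborel {0..<1}"

lemma space_unit_interval: "space unit_interval = {0..<1}"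
  by (simp add: unit_interval_def space_restrict_space)

interpretation unit_interval: prob_space unit_interval
  by standard (simp add: unit_interval_def emeasure_restrict_space space_restrict_space)

lemma borel_measurable_unit_interval:
  "f \<in> borel_measurable borel \<Longrightarrow> f \<in> borel_measurable unit_interval"
  unfolding unit_interval_def by (rule measurable_restrict_space1) simp

lemma integrable_unit_interval:
  fixes f :: "real \<Rightarrow> real"
  assumes "f \<in> borel_measurable borel" "\<And>y. \<bar>f y\<bar> \<le> B"
  shows "integrable unit_interval f"
proof (rule unit_interval.integrable_const_bound)
  show "AE y in unit_interval. norm (f y) \<le> B" using assms(2) by simp
qed (rule borel_measurable_unit_interval[OF assms(1)])

lemma integral_unit_interval_mono:
  fixes f g :: "real \<Rightarrow> real"
  assumes "f \<in> borel_measurable borel" "\<And>y. \<bar>f y\<bar> \<le> B" "g \<in> borel_measurable borel"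
    "\<And>y. \<bar>g y\<bar> \<le> B'" "\<And>y. f y \<le> g y"
  shows "(\<integral>y. f y \<partial>unit_interval) \<le> (\<integral>y. g y \<partial>unit_interval)"
  by (rule integral_mono[OF integrable_unit_interval[OF assms(1,2)] integrable_unit_interval[OF assms(3,4)] assms(5)])

section \<open>Integer part and fractional part of \<open>q * y\<close>\<close>

lemma borel_measurable_floor_fun:
  fixes G :: "int \<Rightarrow> real"
  shows "(\<lambda>y::real. G \<lfloor>r * y\<rfloor>) \<in> borel_measurable borel"
proof -
  have "(\<lambda>y::real. \<lfloor>r * y\<rfloor>) \<in> measurable borel (count_space UNIV)" by measurable
  then show ?thesis by (rule measurable_compose) simp
qed

lemma borel_measurable_frac_less:
  "(\<lambda>y::real. of_bool (frac (r * y) < s) :: real) \<in> borel_measurable borel"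
  unfolding frac_def of_bool_def by measurable

text \<open>On each of the \<open>q\<close> cells of length \<open>1 / q\<close> the integer part of
  \<open>q * y\<close> is constant while the fractional part runs uniformly through the unit
  interval: the two are independent.\<close>

lemma integral_floor_frac:
  fixes G :: "int \<Rightarrow> real"
  assumes q: "0 < q" and d: "0 \<le> d" "d \<le> 1"
  shows "(\<integral>y. G \<lfloor>real q * y\<rfloor> * of_bool (frac (real q * y) < d) \<partial>unit_interval)
    = d * (\<integral>y. G \<lfloor>real q * y\<rfloor> \<partial>unit_interval)"
proof -
  let ?I = "\<lambda>e j. {real j / real q ..< (real j + e) / real q}"
  have step: "(\<integral>y. G \<lfloor>real q * y\<rfloor> * of_bool (frac (real q * y) < e) \<partial>unit_interval)
      = e * ((\<Sum>j<q. G (int j)) / q)" if e: "0 \<le> e" "e \<le> 1" for e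
  proof -
    have pt: "G \<lfloor>real q * y\<rfloor> * of_bool (frac (real q * y) < e)
        = (\<Sum>j<q. G (int j) * indicator (?I e j) y)" if y: "y \<in> space unit_interval" for y
    proof -
      define k where "k = nat \<lfloor>real q * y\<rfloor>"
      have y01: "0 \<le> y" "y < 1" using y by (auto simp: space_unit_interval)
      have fl: "\<lfloor>real q * y\<rfloor> = int k" using y01 by (simp add: k_def)
      have qy: "real q * y < real q" using y01 q by simp
      have kq: "k < q" using fl qy by linarith
      have ind: "indicator (?I e j) y = (if j = k then of_bool (frac (real q * y) < e) else 0 :: real)"
        for j
      proof -
        have "y \<in> ?I e j \<longleftrightarrow> real j \<le> real q * y \<and> real q * y < real j + e"
          using q by (simp add: field_simps)
        also have "\<dots> \<longleftrightarrow> j = k \<and> frac (real q * y) < e"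
        proof
          assume a: "real j \<le> real q * y \<and> real q * y < real j + e"
          then have "\<lfloor>real q * y\<rfloor> = int j" using e by (intro floor_unique) auto
          then show "j = k \<and> frac (real q * y) < e" using a fl by (simp add: frac_def)
        next
          assume a: "j = k \<and> frac (real q * y) < e"
          then show "real j \<le> real q * y \<and> real q * y < real j + e"
            using fl by (simp add: frac_def) linarith
        qed
        finally show ?thesis by (simp add: indicator_def)
      qed
      have "(\<Sum>j<q. G (int j) * indicator (?I e j) y)
          = (\<Sum>j<q. if j = k then G (int k) * of_bool (frac (real q * y) < e) else 0)"
        by (intro sum.cong) (auto simp: ind)
      also have "\<dots> = G \<lfloor>real q * y\<rfloor> * of_bool (frac (real q * y) < e)"
        using kq fl by simp
      finally show ?thesis by simp
    qed
    have sub: "?I e j \<subseteq> {0..<1}" if "j < q" for j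
    proof
      fix y assume y: "y \<in> ?I e j"
      have "real j + e \<le> real q" using that e by linarith
      then have "(real j + e) / real q \<le> 1" using q by simp
      then show "y \<in> {0..<1}" using y by (auto intro: order_trans[of 0 "real j / real q"])
    qed
    have m: "measure unit_interval (?I e j) = e / q" if "j < q" for j
    proof -
      have "measure unit_interval (?I e j) = measure lborel (?I e j)"
        unfolding unit_interval_def using sub[OF that] by (intro measure_restrict_space) auto
      also have "\<dots> = e / q" using e q by (simp add: diff_divide_distrib[symmetric] divide_right_mono)
      finally show ?thesis .
    qed
    have sets: "?I e j \<in> sets unit_interval" if "j < q" for j
      unfolding unit_interval_def sets_restrict_space
      using sub[OF that] by (intro image_eqI[where x = "?I e j"]) auto
    have "(\<integral>y. G \<lfloor>real q * y\<rfloor> * of_bool (frac (real q * y) < e) \<partial>unit_interval)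
        = (\<integral>y. (\<Sum>j<q. G (int j) * indicator (?I e j) y) \<partial>unit_interval)"
      by (intro Bochner_Integration.integral_cong refl pt)
    also have "\<dots> = (\<Sum>j<q. \<integral>y. G (int j) * indicator (?I e j) y \<partial>unit_interval)"
      using sets by (intro Bochner_Integration.integral_sum integrable_mult_right integrable_real_indicator)
        (auto simp: unit_interval.emeasure_eq_measure)
    also have "\<dots> = (\<Sum>j<q. G (int j) * (e / q))"
      using m sets.sets_into_space[OF sets] by (intro sum.cong) (auto simp: Int_absorb2)
    finally show ?thesis by (simp add: sum_distrib_left sum_divide_distrib mult.commute)
  qed
  \<comment> \<open>A fractional part is always below 1, so the case \<open>e = 1\<close> of
    \<open>step\<close> evaluates the integral of \<open>G\<close> alone.\<close>
  have "(\<integral>y. G \<lfloor>real q * y\<rfloor> \<partial>unit_interval)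
      = (\<integral>y. G \<lfloor>real q * y\<rfloor> * of_bool (frac (real q * y) < 1) \<partial>unit_interval)"
    by (simp add: frac_lt_1)
  also have "\<dots> = (\<Sum>j<q. G (int j)) / q" using step[of 1] by simp
  finally show ?thesis using step[OF d] by simp
qed

lemma integral_frac_less:
  assumes "0 < q" "0 \<le> d" "d \<le> 1"
  shows "(\<integral>y. of_bool (frac (real q * y) < d) \<partial>unit_interval) = d"
  using integral_floor_frac[OF assms, of "\<lambda>_. 1"] unit_interval.prob_space by simp

text \<open>In use \<^term>\<open>q\<close> is a power of the base; the digits after that scale are almost uncorrelated with
  a function that \<open>L\<^sup>1\<close>-almost depends on the digits before it only.\<close>

definition digit_approx :: "nat \<Rightarrow> real \<Rightarrow> (real \<Rightarrow> real) \<Rightarrow> bool" where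
  "digit_approx q e F \<longleftrightarrow> F \<in> borel_measurable borel \<and> (\<forall>y. \<bar>F y\<bar> \<le> 1) \<and>
     (\<exists>G. (\<forall>j::int. \<bar>G j\<bar> \<le> 1) \<and> (\<integral>y. \<bar>F y - G \<lfloor>real q * y\<rfloor>\<bar> \<partial>unit_interval) \<le> e)"

text \<open>With approximants \<open>g\<close> and \<open>g'\<close>, write
  \<open>F * F' - g * g'\<close> as \<open>(F - g) * F' + g * (F' - g')\<close>; since
  \<open>F'\<close> and \<open>g\<close> are bounded by 1, the errors add.\<close>

lemma digit_approx_mult:
  assumes "digit_approx q e F" "digit_approx q e' F'"
  shows "digit_approx q (e + e') (\<lambda>y. F y * F' y)"
proof -
  obtain G where F[measurable]: "F \<in> borel_measurable borel" and F1: "\<And>y. \<bar>F y\<bar> \<le> 1"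
    and G: "\<And>j. \<bar>G j\<bar> \<le> 1" "(\<integral>y. \<bar>F y - G \<lfloor>real q * y\<rfloor>\<bar> \<partial>unit_interval) \<le> e"
    using assms(1) unfolding digit_approx_def by blast
  obtain G' where F'[measurable]: "F' \<in> borel_measurable borel" and F1': "\<And>y. \<bar>F' y\<bar> \<le> 1"
    and G': "\<And>j. \<bar>G' j\<bar> \<le> 1" "(\<integral>y. \<bar>F' y - G' \<lfloor>real q * y\<rfloor>\<bar> \<partial>unit_interval) \<le> e'"
    using assms(2) unfolding digit_approx_def by blast
  let ?g = "\<lambda>y. G \<lfloor>real q * y\<rfloor>" and ?g' = "\<lambda>y. G' \<lfloor>real q * y\<rfloor>"
  note [measurable] = borel_measurable_floor_fun[of G "real q"] borel_measurable_floor_fun[of G' "real q"]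
  have b: "\<bar>F y - ?g y\<bar> \<le> 2" "\<bar>F' y - ?g' y\<bar> \<le> 2" for y
    using F1[of y] F1'[of y] G(1)[of "\<lfloor>real q * y\<rfloor>"] G'(1)[of "\<lfloor>real q * y\<rfloor>"] by linarith+
  have pt: "\<bar>F y * F' y - ?g y * ?g' y\<bar> \<le> \<bar>F y - ?g y\<bar> + \<bar>F' y - ?g' y\<bar>" for y
  proof -
    have "\<bar>F y * F' y - ?g y * ?g' y\<bar> = \<bar>(F y - ?g y) * F' y + ?g y * (F' y - ?g' y)\<bar>"
      by (simp add: algebra_simps)
    also have "\<dots> \<le> \<bar>F y - ?g y\<bar> * \<bar>F' y\<bar> + \<bar>?g y\<bar> * \<bar>F' y - ?g' y\<bar>"
      by (metis abs_mult abs_triangle_ineq)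
    also have "\<dots> \<le> \<bar>F y - ?g y\<bar> * 1 + 1 * \<bar>F' y - ?g' y\<bar>"
      using F1'[of y] G(1) by (intro add_mono mult_mono) auto
    finally show ?thesis by simp
  qed
  have "(\<integral>y. \<bar>F y * F' y - ?g y * ?g' y\<bar> \<partial>unit_interval)
      \<le> (\<integral>y. \<bar>F y - ?g y\<bar> + \<bar>F' y - ?g' y\<bar> \<partial>unit_interval)"
  proof (rule integral_unit_interval_mono[where B = 4 and B' = 4])
    show "\<bar>\<bar>F y - ?g y\<bar> + \<bar>F' y - ?g' y\<bar>\<bar> \<le> 4" for y using b[of y] by linarith
    show "\<bar>\<bar>F y * F' y - ?g y * ?g' y\<bar>\<bar> \<le> 4" for y using b[of y] pt[of y] by linarith
  qed (use pt in auto)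
  also have "\<dots> = (\<integral>y. \<bar>F y - ?g y\<bar> \<partial>unit_interval) + (\<integral>y. \<bar>F' y - ?g' y\<bar> \<partial>unit_interval)"
    using b by (intro Bochner_Integration.integral_add integrable_unit_interval[where B = 2]) auto
  finally have "(\<integral>y. \<bar>F y * F' y - ?g y * ?g' y\<bar> \<partial>unit_interval) \<le> e + e'"
    using G(2) G'(2) by linarith
  moreover have "\<bar>G j * G' j\<bar> \<le> 1" for j
    using mult_mono[OF G(1)[of j] G'(1)[of j]] by (simp add: abs_mult)
  moreover have "\<bar>F y * F' y\<bar> \<le> 1" for y
    using mult_mono[OF F1[of y] F1'[of y]] by (simp add: abs_mult)
  ultimately show ?thesis
    unfolding digit_approx_def by (intro conjI exI[of _ "\<lambda>j. G j * G' j"]) auto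
qed

text \<open>The residue is the integer part of \<open>t * frac x\<close>. Hence comparing
  \<open>frac x\<close> with a multiple of \<open>1 / t\<close> requires only the integer
  \<open>\<lfloor>t * x\<rfloor>\<close>.\<close>

lemma floor_mod_less_iff:
  assumes "0 < t"
  shows "\<lfloor>real t * x\<rfloor> mod int t < i \<longleftrightarrow> frac x < of_int i / real t"
proof -
  have fr: "0 \<le> frac x" "frac x < 1" by (auto simp: frac_lt_1)
  have "real t * x = of_int (int t * \<lfloor>x\<rfloor>) + real t * frac x"
    by (simp add: frac_def algebra_simps)
  then have "\<lfloor>real t * x\<rfloor> = int t * \<lfloor>x\<rfloor> + \<lfloor>real t * frac x\<rfloor>"
    by (metis floor_add_int add.commute)
  moreover have "0 \<le> \<lfloor>real t * frac x\<rfloor>" using fr assms by simp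
  moreover have "\<lfloor>real t * frac x\<rfloor> < int t"
    using fr assms by (simp add: floor_less_iff)
  ultimately have "\<lfloor>real t * x\<rfloor> mod int t = \<lfloor>real t * frac x\<rfloor>"
    by simp
  then show ?thesis
    using assms by (simp add: floor_less_iff pos_less_divide_eq mult.commute)
qed

lemma abs_of_bool_diff_le: "0 \<le> s \<Longrightarrow> s \<le> 1 \<Longrightarrow> \<bar>of_bool P - s\<bar> \<le> (1 :: real)"
  by (cases P) auto

text \<open>Rounding the threshold \<open>s\<close> down to a multiple \<open>d\<close> of
  \<open>1 / t\<close> gives an indicator that is a function of
  \<open>\<lfloor>r * t * y\<rfloor>\<close>; it differs from the original one on a set of measure
  \<open>s - d \<le> 1 / t\<close>.\<close>

lemma digit_approx_frac_less:
  assumes r: "0 < r" and t: "0 < t" and s: "0 \<le> s" "s \<le> 1"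
  shows "digit_approx (r * t) (1 / t) (\<lambda>y. of_bool (frac (real r * y) < s) - s)"
proof -
  define i where "i = \<lfloor>s * t\<rfloor>"
  define d where "d = of_int i / real t"
  have d: "0 \<le> d" "d \<le> s" "s \<le> d + 1 / t"
  proof -
    have "of_int i \<le> s * t" "s * t < of_int i + 1" unfolding i_def by linarith+
    then show "d \<le> s" "s \<le> d + 1 / t"
      using t by (simp_all add: d_def field_simps)
    show "0 \<le> d" using s by (simp add: d_def i_def)
  qed
  define G :: "int \<Rightarrow> real" where "G j = of_bool (j mod int t < i) - s" for j
  have G: "G \<lfloor>real (r * t) * y\<rfloor> = of_bool (frac (real r * y) < d) - s" for y
    using floor_mod_less_iff[OF t, of "real r * y" i] by (simp add: G_def d_def ac_simps)
  have int: "integrable unit_interval (\<lambda>y. of_bool (frac (real r * y) < e) :: real)" for e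
    by (rule integrable_unit_interval[where B = 1, OF borel_measurable_frac_less]) simp
  have "(\<integral>y. \<bar>(of_bool (frac (real r * y) < s) - s) - G \<lfloor>real (r * t) * y\<rfloor>\<bar> \<partial>unit_interval)
      = (\<integral>y. of_bool (frac (real r * y) < s) - of_bool (frac (real r * y) < d) \<partial>unit_interval)"
  proof (rule Bochner_Integration.integral_cong[OF refl])
    fix y show "\<bar>(of_bool (frac (real r * y) < s) - s) - G \<lfloor>real (r * t) * y\<rfloor>\<bar>
        = of_bool (frac (real r * y) < s) - of_bool (frac (real r * y) < d)"
      unfolding G using d(2) by (cases "frac (real r * y) < d") auto
  qed
  also have "\<dots> = s - d"
    using integral_frac_less[OF r s] integral_frac_less[OF r d(1)] s d int by simp
  also have "\<dots> \<le> 1 / t" using d by simp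
  finally have "(\<integral>y. \<bar>(of_bool (frac (real r * y) < s) - s) - G \<lfloor>real (r * t) * y\<rfloor>\<bar> \<partial>unit_interval)
      \<le> 1 / t" .
  moreover have "\<bar>G j\<bar> \<le> 1" for j unfolding G_def by (rule abs_of_bool_diff_le[OF s])
  ultimately show ?thesis
    unfolding digit_approx_def using abs_of_bool_diff_le[OF s] borel_measurable_frac_less[of "real r" s]
    by (intro conjI exI[of _ G] allI) auto
qed

text \<open>The approximant of \<open>F\<close> is exactly uncorrelated with the centred indicator
  by \<open>integral_floor_frac\<close>. Replacing \<open>F\<close> by it costs at most
  \<open>e\<close>, as the centred indicator is bounded by 1.\<close>

lemma digit_approx_correlation:
  assumes F: "digit_approx q e F" and q: "0 < q" and s: "0 \<le> s" "s \<le> 1"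
  shows "\<bar>\<integral>y. F y * (of_bool (frac (real q * y) < s) - s) \<partial>unit_interval\<bar> \<le> e"
proof -
  obtain G where F[measurable]: "F \<in> borel_measurable borel" and F1: "\<And>y. \<bar>F y\<bar> \<le> 1"
    and G: "\<And>j. \<bar>G j\<bar> \<le> 1" "(\<integral>y. \<bar>F y - G \<lfloor>real q * y\<rfloor>\<bar> \<partial>unit_interval) \<le> e"
    using F unfolding digit_approx_def by blast
  let ?g = "\<lambda>y. G \<lfloor>real q * y\<rfloor>" and ?b = "\<lambda>y. of_bool (frac (real q * y) < s) :: real"
  note [measurable] = borel_measurable_floor_fun[of G "real q"] borel_measurable_frac_less[of "real q" s]
  have b1: "\<bar>?b y - s\<bar> \<le> 1" for y by (rule abs_of_bool_diff_le[OF s])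
  have Fg: "\<bar>F y - ?g y\<bar> \<le> 2" for y using F1[of y] G(1)[of "\<lfloor>real q * y\<rfloor>"] by linarith
  have prod: "\<bar>(F y - ?g y) * (?b y - s)\<bar> \<le> \<bar>F y - ?g y\<bar>" for y
    unfolding abs_mult using b1[of y] by (intro mult_left_le) auto
  have prod2: "\<bar>(F y - ?g y) * (?b y - s)\<bar> \<le> 2" for y
    using prod[of y] Fg[of y] by linarith
  have "\<bar>?g y * ?b y\<bar> \<le> 1" for y
    using G(1)[of "\<lfloor>real q * y\<rfloor>"] by (cases "frac (real q * y) < s") auto
  then have i1: "integrable unit_interval (\<lambda>y. ?g y * ?b y)" "integrable unit_interval ?g"
    using G(1) by (auto intro!: integrable_unit_interval[where B = 1])
  have i2: "integrable unit_interval (\<lambda>y. (F y - ?g y) * (?b y - s))"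
    using prod2 by (intro integrable_unit_interval[where B = 2]) auto
  have "(\<integral>y. F y * (?b y - s) \<partial>unit_interval)
      = (\<integral>y. (F y - ?g y) * (?b y - s) + (?g y * ?b y - s * ?g y) \<partial>unit_interval)"
    by (simp add: algebra_simps)
  also have "\<dots> = (\<integral>y. (F y - ?g y) * (?b y - s) \<partial>unit_interval)
      + ((\<integral>y. ?g y * ?b y \<partial>unit_interval) - s * (\<integral>y. ?g y \<partial>unit_interval))"
    using i1 i2 by simp
  also have "\<dots> = (\<integral>y. (F y - ?g y) * (?b y - s) \<partial>unit_interval)"
    using integral_floor_frac[OF q s, of G] by simp
  finally have "\<bar>\<integral>y. F y * (?b y - s) \<partial>unit_interval\<bar>
      \<le> (\<integral>y. \<bar>(F y - ?g y) * (?b y - s)\<bar> \<partial>unit_interval)"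
    by (simp add: integral_abs_bound)
  also have "\<dots> \<le> (\<integral>y. \<bar>F y - ?g y\<bar> \<partial>unit_interval)"
    using prod prod2 Fg by (intro integral_unit_interval_mono[where B = 2 and B' = 2]) auto
  finally show ?thesis using G(2) by linarith
qed

text \<open>Twice the sum of the absolute autocorrelations: it bounds
  \<open>\<parallel>\<Sum>n<N. c n *\<^sub>R U\<^sup>n f\<parallel>\<^sup>2 / \<parallel>f\<parallel>\<^sup>2\<close> for every isometry \<open>U\<close>.\<close>

definition correlation_sum :: "(nat \<Rightarrow> real) \<Rightarrow> nat \<Rightarrow> real" where
  "correlation_sum c N = 2 * (\<Sum>h<N. \<bar>\<Sum>n<N - h. c n * c (n + h)\<bar>)"

text \<open>Monotonicity of \<open>s\<close> enters in product form so that \<open>s 0 = 0\<close>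
  is allowed: this is the value of \<open>n powr (- a)\<close> at \<open>n = 0\<close>.\<close>

locale digit_process =
  fixes p :: nat and s :: "nat \<Rightarrow> real"
  assumes p: "2 \<le> p" and s_nonneg: "\<And>n. 0 \<le> s n" and s_le_1: "\<And>n. s n \<le> 1"
    and s_mult_le: "\<And>n h. s n * s (n + h) \<le> (s n)\<^sup>2"
begin

definition dev :: "nat \<Rightarrow> real \<Rightarrow> real" where
  "dev n y = of_bool (frac (real p ^ n * y) < s n) - s n"

lemma abs_dev_le_1: "\<bar>dev n y\<bar> \<le> 1"
  unfolding dev_def by (rule abs_of_bool_diff_le[OF s_nonneg s_le_1])

lemma borel_measurable_dev [measurable]: "dev n \<in> borel_measurable borel"
  unfolding dev_def using borel_measurable_frac_less[of "real p ^ n" "s n"] by simp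

lemma dev_eq: "dev n = (\<lambda>y. of_bool (frac (real (p ^ n) * y) < s n) - s n)"
  by (simp add: dev_def fun_eq_iff)

lemma abs_mult_le_1: "\<bar>u\<bar> \<le> 1 \<Longrightarrow> \<bar>v\<bar> \<le> 1 \<Longrightarrow> \<bar>u * v\<bar> \<le> (1 :: real)"
  unfolding abs_mult using mult_mono[of "\<bar>u\<bar>" 1 "\<bar>v\<bar>" 1] by simp

text \<open>At scale \<open>p ^ m\<close> the \<open>m - n\<close> base-\<open>p\<close> digits
  following place \<open>n\<close> are known, so the threshold is resolved up to
  \<open>1 / p ^ (m - n)\<close>, at most \<open>1 / 2 ^ K\<close>.\<close>

lemma digit_approx_dev:
  assumes "n + K \<le> m"
  shows "digit_approx (p ^ m) (1 / 2 ^ K) (dev n)"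
proof -
  have m: "p ^ m = p ^ n * p ^ (m - n)" using assms by (simp add: power_add[symmetric])
  have "(2 :: real) ^ K \<le> real p ^ K" using p by (intro power_mono) auto
  also have "\<dots> \<le> real p ^ (m - n)" using p assms by (intro power_increasing) auto
  finally have "1 / real (p ^ (m - n)) \<le> 1 / 2 ^ K"
    by (simp add: frac_le)
  moreover have "digit_approx (p ^ m) (1 / real (p ^ (m - n))) (dev n)"
    unfolding m dev_eq using p s_nonneg s_le_1 by (intro digit_approx_frac_less) auto
  ultimately show ?thesis unfolding digit_approx_def by (meson order_trans)
qed

lemma digit_approx_dev_correlation:
  assumes "digit_approx (p ^ m) e F"
  shows "\<bar>\<integral>y. F y * dev m y \<partial>unit_interval\<bar> \<le> e"
  unfolding dev_eq using p assms s_nonneg s_le_1 by (intro digit_approx_correlation) auto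

lemma integral_dev: "(\<integral>y. dev n y \<partial>unit_interval) = 0"
proof -
  have "integrable unit_interval (\<lambda>y. of_bool (frac (real (p ^ n) * y) < s n) :: real)"
    by (rule integrable_unit_interval[where B = 1, OF borel_measurable_frac_less]) simp
  then show ?thesis
    unfolding dev_eq using integral_frac_less[of "p ^ n" "s n"] p s_nonneg s_le_1
    by (simp add: unit_interval.prob_space)
qed

section \<open>Moments of the centred indicators and of their autocorrelations\<close>

lemma integrable_dev: "integrable unit_interval (dev n)"
  by (rule integrable_unit_interval[OF borel_measurable_dev abs_dev_le_1])

lemma integrable_dev_mult: "integrable unit_interval (\<lambda>y. dev n y * dev m y)"
  by (rule integrable_unit_interval[where B = 1]) (auto intro: abs_mult_le_1 abs_dev_le_1)

text \<open>The only negative value is \<open>- s n\<close>. The majorant is affine in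
  \<open>dev n y\<close>, so its integral is read off from the mean of \<open>dev n\<close> being
  zero.\<close>

lemma abs_dev_le: "\<bar>dev n y\<bar> \<le> dev n y + 2 * s n"
  using s_nonneg[of n] s_le_1[of n] by (auto simp: dev_def)

lemma integral_abs_dev_le: "(\<integral>y. \<bar>dev n y\<bar> \<partial>unit_interval) \<le> 2 * s n"
proof -
  have "(\<integral>y. \<bar>dev n y\<bar> \<partial>unit_interval) \<le> (\<integral>y. dev n y + 2 * s n \<partial>unit_interval)"
    using integrable_dev abs_dev_le by (intro integral_mono) auto
  also have "\<dots> = 2 * s n"
    using integrable_dev integral_dev by (simp add: unit_interval.prob_space)
  finally show ?thesis .
qed

text \<open>In the product of the two affine majorants the linear terms have mean zero; what remains
  is the correlation, at most \<open>1 / 2 ^ h\<close>, and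
  \<open>4 * s n * s (n + h)\<close>.\<close>

lemma integral_abs_dev_mult_le:
  "(\<integral>y. \<bar>dev n y * dev (n + h) y\<bar> \<partial>unit_interval) \<le> 4 * (s n)\<^sup>2 + 1 / 2 ^ h"
proof -
  let ?b = "\<lambda>y. dev n y * dev (n + h) y + 2 * s n * dev (n + h) y + 2 * s (n + h) * dev n y
    + 4 * (s n * s (n + h))"
  have "(\<integral>y. \<bar>dev n y * dev (n + h) y\<bar> \<partial>unit_interval) \<le> (\<integral>y. ?b y \<partial>unit_interval)"
  proof (rule integral_mono)
    fix y
    have "\<bar>dev n y * dev (n + h) y\<bar> \<le> (dev n y + 2 * s n) * (dev (n + h) y + 2 * s (n + h))"
      unfolding abs_mult using abs_dev_le[of n y] by (intro mult_mono abs_dev_le) auto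
    then show "\<bar>dev n y * dev (n + h) y\<bar> \<le> ?b y" by (simp add: algebra_simps)
  qed (use integrable_dev integrable_dev_mult in auto)
  also have "\<dots> = (\<integral>y. dev n y * dev (n + h) y \<partial>unit_interval) + 4 * (s n * s (n + h))"
    using integrable_dev integrable_dev_mult integral_dev by (simp add: unit_interval.prob_space)
  also have "(\<integral>y. dev n y * dev (n + h) y \<partial>unit_interval) \<le> 1 / 2 ^ h"
    using digit_approx_dev_correlation[OF digit_approx_dev[of n h "n + h"]] by simp
  finally show ?thesis using s_mult_le[of n h] by simp
qed

text \<open>The index \<open>m\<close> exceeds the other three by at least \<open>K\<close>, and
  each of those three factors contributes one error \<open>1 / 2 ^ K\<close>.\<close>

lemma integral_dev_four_le:
  assumes "n1 + K \<le> m" "n2 + K \<le> m" "n3 + K \<le> m"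
  shows "(\<integral>y. dev n1 y * dev n2 y * dev n3 y * dev m y \<partial>unit_interval) \<le> 3 / 2 ^ K"
  using digit_approx_dev_correlation[OF digit_approx_mult[OF digit_approx_mult[OF
    digit_approx_dev[OF assms(1)] digit_approx_dev[OF assms(2)]] digit_approx_dev[OF assms(3)]]]
  by simp

text \<open>Expand the square. If \<open>n\<close> and \<open>m\<close> differ by at least
  \<open>K\<close>, then, as \<open>h \<ge> K\<close> too, the largest of the four indices is
  isolated and the term is at most \<open>3 / 2 ^ K\<close>. Each \<open>n\<close> has at most
  \<open>2 * K\<close> remaining partners, for which the second pair is bounded by 1 and the first
  pair is estimated in mean.\<close>

lemma integral_correlation_square_le:
  assumes K: "K \<le> h" "K \<le> N"
  shows "(\<integral>y. (\<Sum>n<N - h. dev n y * dev (n + h) y)\<^sup>2 \<partial>unit_interval)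
    \<le> 5 * (real N)\<^sup>2 / 2 ^ K + 8 * real K * (\<Sum>n<N. (s n)\<^sup>2)"
proof -
  let ?d = "\<lambda>n y. dev n y * dev (n + h) y"
  let ?near = "\<lambda>n m. n < m + K \<and> m < n + K"
  have d1: "\<bar>?d n y\<bar> \<le> 1" for n y by (intro abs_mult_le_1 abs_dev_le_1)
  have int: "integrable unit_interval (\<lambda>y. ?d n y * ?d m y)" for n m
    by (rule integrable_unit_interval[where B = 1]) (auto intro: abs_mult_le_1 abs_dev_le_1)
  have inta: "integrable unit_interval (\<lambda>y. \<bar>?d n y\<bar>)" for n
    using integrable_dev_mult by auto
  have pair: "(\<integral>y. ?d n y * ?d m y \<partial>unit_interval)
      \<le> 3 / 2 ^ K + of_bool (?near n m) * (4 * (s n)\<^sup>2 + 1 / 2 ^ K)" for n m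
  proof -
    consider "n + K \<le> m" | "m + K \<le> n" | "?near n m" by linarith
    then show ?thesis
    proof cases
      case 1
      then have "(\<integral>y. ?d n y * ?d m y \<partial>unit_interval) \<le> 3 / 2 ^ K"
        using integral_dev_four_le[of n K "m + h" "n + h" m] K(1) by (simp add: ac_simps)
      then show ?thesis using 1 by simp
    next
      case 2
      then have "(\<integral>y. ?d n y * ?d m y \<partial>unit_interval) \<le> 3 / 2 ^ K"
        using integral_dev_four_le[of m K "n + h" "m + h" n] K(1) by (simp add: ac_simps)
      then show ?thesis using 2 by simp
    next
      case 3
      have "(\<integral>y. ?d n y * ?d m y \<partial>unit_interval) \<le> (\<integral>y. \<bar>?d n y\<bar> \<partial>unit_interval)"
      proof (rule integral_mono[OF int inta])
        fix y
        have "\<bar>?d n y * ?d m y\<bar> \<le> \<bar>?d n y\<bar>"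
          unfolding abs_mult[of "?d n y"] using d1[of m y] by (intro mult_left_le) auto
        then show "?d n y * ?d m y \<le> \<bar>?d n y\<bar>" by linarith
      qed
      also have "\<dots> \<le> 4 * (s n)\<^sup>2 + 1 / 2 ^ h" by (rule integral_abs_dev_mult_le)
      also have "(1 :: real) / 2 ^ h \<le> 1 / 2 ^ K" using K(1) by (intro divide_left_mono power_increasing) auto
      finally show ?thesis using 3 by (intro add_increasing) auto
    qed
  qed
  have near: "(\<Sum>m<N - h. of_bool (?near n m) :: real) \<le> 2 * K" for n
  proof -
    have "(\<Sum>m<N - h. of_bool (?near n m) :: real) = card ({..<N - h} \<inter> {m. ?near n m})"
      by (simp add: sum_of_bool_eq)
    also have "card ({..<N - h} \<inter> {m. ?near n m}) \<le> card {n + 1 - K..<n + K}"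
      by (intro card_mono) auto
    also have "\<dots> \<le> 2 * K" by simp
    finally show ?thesis by simp
  qed
  have "(\<integral>y. (\<Sum>n<N - h. ?d n y)\<^sup>2 \<partial>unit_interval)
      = (\<integral>y. (\<Sum>n<N - h. \<Sum>m<N - h. ?d n y * ?d m y) \<partial>unit_interval)"
    by (simp add: power2_eq_square sum_product)
  also have "\<dots> = (\<Sum>n<N - h. \<Sum>m<N - h. \<integral>y. ?d n y * ?d m y \<partial>unit_interval)"
    using int by (simp add: Bochner_Integration.integral_sum)
  also have "\<dots> \<le> (\<Sum>n<N - h. \<Sum>m<N - h. 3 / 2 ^ K + of_bool (?near n m) * (4 * (s n)\<^sup>2 + 1 / 2 ^ K))"
    by (intro sum_mono pair)
  also have "\<dots> = (\<Sum>n<N - h. real (N - h) * (3 / 2 ^ K)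
      + (\<Sum>m<N - h. of_bool (?near n m)) * (4 * (s n)\<^sup>2 + 1 / 2 ^ K))"
    by (simp add: sum.distrib sum_distrib_right)
  also have "\<dots> \<le> (\<Sum>n<N - h. real N * (3 / 2 ^ K) + 2 * K * (4 * (s n)\<^sup>2 + 1 / 2 ^ K))"
    by (intro sum_mono add_mono mult_right_mono near) auto
  also have "\<dots> \<le> (\<Sum>n<N. real N * (3 / 2 ^ K) + 2 * K * (4 * (s n)\<^sup>2 + 1 / 2 ^ K))"
    by (intro sum_mono2) auto
  also have "\<dots> = real N * (real N * (3 / 2 ^ K)) + 8 * K * (\<Sum>n<N. (s n)\<^sup>2) + real N * (2 * K * (1 / 2 ^ K))"
    by (simp add: sum.distrib sum_distrib_left algebra_simps)
  \<comment> \<open>\<open>K \<le> N\<close> turns the last term into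
    \<open>2 * N ^ 2 / 2 ^ K\<close>, whence the constant 5.\<close>
  also have "\<dots> \<le> real N * (real N * (3 / 2 ^ K)) + 8 * K * (\<Sum>n<N. (s n)\<^sup>2) + real N * (2 * N * (1 / 2 ^ K))"
    using K(2) by (intro add_mono mult_left_mono mult_right_mono) auto
  also have "\<dots> = 5 * (real N)\<^sup>2 / 2 ^ K + 8 * real K * (\<Sum>n<N. (s n)\<^sup>2)"
    by (simp add: power2_eq_square field_simps)
  finally show ?thesis .
qed

text \<open>The fewer than \<open>K + 1\<close> short differences are bounded trivially in mean. For
  \<open>h \<ge> K\<close> the inequality \<open>\<bar>Z\<bar> \<le> (l + Z ^ 2 / l) / 2\<close>
  plays the part of Cauchy-Schwarz, with \<open>l\<close> left free to be balanced against the
  second moment.\<close>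

lemma integral_correlation_sum_le:
  assumes K: "K \<le> N" and l: "0 < l"
  shows "(\<integral>y. correlation_sum (\<lambda>n. dev n y) N \<partial>unit_interval)
    \<le> 4 * real K * (\<Sum>n<N. s n)
      + real N * (l + (5 * (real N)\<^sup>2 / 2 ^ K + 8 * real K * (\<Sum>n<N. (s n)\<^sup>2)) / l)"
    and "integrable unit_interval (\<lambda>y. correlation_sum (\<lambda>n. dev n y) N)"
proof -
  let ?d = "\<lambda>n h y. dev n y * dev (n + h) y"
  let ?Z = "\<lambda>h y. \<Sum>n<N - h. ?d n h y"
  let ?B = "5 * (real N)\<^sup>2 / 2 ^ K + 8 * real K * (\<Sum>n<N. (s n)\<^sup>2)"
  have iZ: "integrable unit_interval (?Z h)" for h
    using integrable_dev_mult by (intro Bochner_Integration.integrable_sum)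
  have iZ2: "integrable unit_interval (\<lambda>y. (?Z h y)\<^sup>2)" for h
  proof -
    have "integrable unit_interval (\<lambda>y. ?d n h y * ?d m h y)" for n m
      by (rule integrable_unit_interval[where B = 1]) (auto intro: abs_mult_le_1 abs_dev_le_1)
    then show ?thesis
      unfolding power2_eq_square sum_product by (intro Bochner_Integration.integrable_sum)
  qed
  have small: "(\<integral>y. \<bar>?Z h y\<bar> \<partial>unit_interval) \<le> 2 * (\<Sum>n<N. s n)" for h
  proof -
    have "(\<integral>y. \<bar>?Z h y\<bar> \<partial>unit_interval) \<le> (\<integral>y. (\<Sum>n<N. \<bar>dev n y\<bar>) \<partial>unit_interval)"
    proof (rule integral_mono)
      fix y
      have "\<bar>?Z h y\<bar> \<le> (\<Sum>n<N - h. \<bar>?d n h y\<bar>)" by (rule sum_abs)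
      also have "\<dots> \<le> (\<Sum>n<N - h. \<bar>dev n y\<bar>)"
        unfolding abs_mult using abs_dev_le_1 by (intro sum_mono mult_left_le) auto
      also have "\<dots> \<le> (\<Sum>n<N. \<bar>dev n y\<bar>)" by (intro sum_mono2) auto
      finally show "\<bar>?Z h y\<bar> \<le> (\<Sum>n<N. \<bar>dev n y\<bar>)" .
    qed (use iZ integrable_dev in auto)
    also have "\<dots> = (\<Sum>n<N. \<integral>y. \<bar>dev n y\<bar> \<partial>unit_interval)"
      using integrable_dev by (intro Bochner_Integration.integral_sum) auto
    also have "\<dots> \<le> (\<Sum>n<N. 2 * s n)" by (intro sum_mono integral_abs_dev_le)
    finally show ?thesis by (simp add: sum_distrib_left)
  qed
  have large: "(\<integral>y. \<bar>?Z h y\<bar> \<partial>unit_interval) \<le> (l + ?B / l) / 2" if h: "K \<le> h" for h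
  proof -
    have "(\<integral>y. \<bar>?Z h y\<bar> \<partial>unit_interval) \<le> (\<integral>y. (l + (?Z h y)\<^sup>2 / l) / 2 \<partial>unit_interval)"
    proof (rule integral_mono)
      fix y
      have "0 \<le> (\<bar>?Z h y\<bar> - l)\<^sup>2" by simp
      then have "2 * l * \<bar>?Z h y\<bar> \<le> l\<^sup>2 + (?Z h y)\<^sup>2" by (simp add: power2_diff algebra_simps)
      then have "2 * l * \<bar>?Z h y\<bar> / (2 * l) \<le> (l\<^sup>2 + (?Z h y)\<^sup>2) / (2 * l)"
        using l by (intro divide_right_mono) auto
      then show "\<bar>?Z h y\<bar> \<le> (l + (?Z h y)\<^sup>2 / l) / 2"
        using l by (simp add: add_divide_distrib power2_eq_square)
    qed (use iZ iZ2 in auto)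
    also have "\<dots> = (l + (\<integral>y. (?Z h y)\<^sup>2 \<partial>unit_interval) / l) / 2"
      using iZ2 by (simp add: unit_interval.prob_space)
    also have "\<dots> \<le> (l + ?B / l) / 2"
      using integral_correlation_square_le[OF h K] l
      by (intro divide_right_mono add_mono) auto
    finally show ?thesis .
  qed
  have nn: "0 \<le> ?B" "0 \<le> (\<Sum>n<N. s n)"
    using s_nonneg by (auto intro!: sum_nonneg add_nonneg_nonneg mult_nonneg_nonneg)
  have each: "(\<integral>y. \<bar>?Z h y\<bar> \<partial>unit_interval)
      \<le> of_bool (h < K) * (2 * (\<Sum>n<N. s n)) + (l + ?B / l) / 2" for h
    using small[of h] large[of h] nn l by (cases "h < K") (auto simp: add_increasing2)
  have card: "(\<Sum>h<N. of_bool (h < K) :: real) = K"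
  proof -
    have "{..<N} \<inter> {h. h < K} = {..<K}" using K by auto
    then show ?thesis by (simp add: sum_of_bool_eq)
  qed
  show "integrable unit_interval (\<lambda>y. correlation_sum (\<lambda>n. dev n y) N)"
    unfolding correlation_sum_def using iZ by auto
  have "(\<integral>y. correlation_sum (\<lambda>n. dev n y) N \<partial>unit_interval)
      = 2 * (\<Sum>h<N. \<integral>y. \<bar>?Z h y\<bar> \<partial>unit_interval)"
    unfolding correlation_sum_def using iZ by (simp add: Bochner_Integration.integral_sum)
  also have "\<dots> \<le> 2 * (\<Sum>h<N. of_bool (h < K) * (2 * (\<Sum>n<N. s n)) + (l + ?B / l) / 2)"
    by (intro mult_left_mono sum_mono each) simp
  also have "\<dots> = 2 * ((\<Sum>h<N. of_bool (h < K)) * (2 * (\<Sum>n<N. s n)) + N * ((l + ?B / l) / 2))"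
    by (simp only: sum.distrib sum_distrib_right[symmetric] sum_constant card_lessThan)
  also have "\<dots> = 4 * real K * (\<Sum>n<N. s n) + real N * (l + ?B / l)"
    unfolding card by (simp add: algebra_simps)
  finally show "(\<integral>y. correlation_sum (\<lambda>n. dev n y) N \<partial>unit_interval)
      \<le> 4 * real K * (\<Sum>n<N. s n) + real N * (l + ?B / l)" .
qed

end

section \<open>Power weights\<close>

text \<open>Each term is at most the increment of \<open>x powr (1 - b) / (1 - b)\<close> over the
  preceding unit interval; the term at 0 vanishes because \<open>0 powr (- b) = 0\<close>.\<close>

lemma sum_powr_le:
  fixes b :: real
  assumes b: "0 < b" "b < 1"
  shows "(\<Sum>n<Suc N. real n powr (- b)) \<le> real N powr (1 - b) / (1 - b)"
proof (induction N)
  case (Suc N)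
  have "real (Suc N) powr (- b) \<le> (real (Suc N) powr (1 - b) - real N powr (1 - b)) / (1 - b)"
  \<comment> \<open>The mean value theorem is applied with a derivative at both endpoints, and
    \<open>x powr (1 - b)\<close> has none at 0.\<close>
  proof (cases "N = 0")
    case True
    then show ?thesis using b by simp
  next
    case False
    have "\<exists>z. real N < z \<and> z < real (Suc N) \<and>
        real (Suc N) powr (1 - b) - real N powr (1 - b) = (real (Suc N) - real N) * ((1 - b) * z powr (- b))"
    proof (rule MVT2)
      fix x assume "real N \<le> x" "x \<le> real (Suc N)"
      then have "0 < x" using False by simp
      then show "((\<lambda>x. x powr (1 - b)) has_real_derivative (1 - b) * x powr (- b)) (at x)"
        by (auto intro!: derivative_eq_intros)
    qed simp
    then obtain z where z: "real N < z" "z < real (Suc N)"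
      "real (Suc N) powr (1 - b) - real N powr (1 - b) = (1 - b) * z powr (- b)" by auto
    have "real (Suc N) powr (- b) \<le> z powr (- b)"
      using z b by (intro powr_mono2') auto
    then show ?thesis using z b by simp
  qed
  then show ?case using Suc by (simp add: diff_divide_distrib)
qed simp

lemma sum_powr_le':
  fixes b :: real
  assumes b: "0 < b" "b < 1"
  shows "(\<Sum>n<N. real n powr (- b)) \<le> real N powr (1 - b) / (1 - b)"
proof -
  have "(\<Sum>n<N. real n powr (- b)) \<le> (\<Sum>n<Suc N. real n powr (- b))" by simp
  then show ?thesis using sum_powr_le[OF b, of N] by linarith
qed

text \<open>The \<open>N - 1 \<ge> N / 2\<close> terms of positive index are all at least
  \<open>N powr (- b)\<close>.\<close>

lemma sum_powr_ge:
  fixes b :: real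
  assumes b: "0 < b" and N: "2 \<le> N"
  shows "real N powr (1 - b) / 2 \<le> (\<Sum>n<N. real n powr (- b))"
proof -
  have "real N powr (1 - b) / 2 = real N / 2 * real N powr (- b)"
    using N by (simp add: powr_diff powr_minus field_simps)
  also have "\<dots> \<le> real (N - 1) * real N powr (- b)"
    using N by (intro mult_right_mono) auto
  also have "\<dots> = (\<Sum>n\<in>{1..<N}. real N powr (- b))" by simp
  also have "\<dots> \<le> (\<Sum>n\<in>{1..<N}. real n powr (- b))"
    using b by (intro sum_mono powr_mono2') auto
  also have "\<dots> \<le> (\<Sum>n<N. real n powr (- b))" by (intro sum_mono2) auto
  finally show ?thesis .
qed

section \<open>The weights \<open>n powr (- a)\<close> and the choice of the parameters\<close>

locale power_digit_process =
  fixes p :: nat and a :: real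
  assumes p2: "2 \<le> p" and a0: "0 < a" and a_half: "a < 1 / 2"
begin

definition wt :: "nat \<Rightarrow> real" where "wt n = real n powr (- a)"

lemma wt_nonneg: "0 \<le> wt n" by (simp add: wt_def)

lemma wt_antimono: "1 \<le> m \<Longrightarrow> m \<le> n \<Longrightarrow> wt n \<le> wt m"
  unfolding wt_def using a0 by (intro powr_mono2') auto

sublocale digit_process p wt
proof
  show "2 \<le> p" by (rule p2)
  show "0 \<le> wt n" for n by (rule wt_nonneg)
  show "wt n \<le> 1" for n
    using wt_antimono[of 1 n] by (cases "n = 0") (auto simp: wt_def)
  show "wt n * wt (n + h) \<le> (wt n)\<^sup>2" for n h
  proof (cases "n = 0")
    case False
    then have "wt (n + h) \<le> wt n" by (intro wt_antimono) auto
    then show ?thesis by (simp add: power2_eq_square mult_left_mono wt_nonneg)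
  qed (simp add: wt_def)
qed

text \<open>With this value \<open>3 / 2 - a + gap\<close> falls short of \<open>2 - 2 * a\<close>
  by exactly \<open>gap\<close>.\<close>

definition gap :: real where "gap = (1 / 2 - a) / 2"

definition total :: "nat \<Rightarrow> real" where "total N = (\<Sum>n<N. wt n)"

lemma gap: "0 < gap" "gap < 1" using a0 a_half by (auto simp: gap_def)

text \<open>Take \<open>K\<close> about \<open>N powr gap\<close>: this keeps
  \<open>N ^ 2 / 2 ^ K\<close> bounded and costs only the factor \<open>N powr gap\<close>. The
  squares of the weights sum to order \<open>N powr (1 - 2 * a)\<close>, and \<open>l\<close> is
  chosen as the square root \<open>N powr (1 / 2 - a)\<close> of this order.\<close>

lemma integral_correlation_sum_power_le:
  "\<exists>C\<ge>0. \<forall>N\<ge>1. (\<integral>y. correlation_sum (\<lambda>n. dev n y) N \<partial>unit_interval) \<le> C * real N powr (3 / 2 - a + gap)"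
proof -
  have "(\<lambda>N. (real N)\<^sup>2 / 2 powr (real N powr gap)) \<longlonglongrightarrow> 0"
    using gap(1) by real_asymp
  then have "Bseq (\<lambda>N. (real N)\<^sup>2 / 2 powr (real N powr gap))"
    by (rule convergent_imp_Bseq[OF convergentI])
  then obtain B where "\<And>N. norm ((real N)\<^sup>2 / 2 powr (real N powr gap)) \<le> B"
    unfolding Bseq_def by blast
  then have B: "(real N)\<^sup>2 / 2 powr (real N powr gap) \<le> B" for N
    by (metis abs_le_D1 real_norm_def)
  have B0: "0 \<le> B" using B[of 0] by simp
  define C1 where "C1 = 1 / (1 - a)"
  define C2 where "C2 = 1 / (1 - 2 * a)"
  have C: "0 \<le> C1" "0 \<le> C2" using a_half a0 by (auto simp: C1_def C2_def)
  have "(\<integral>y. correlation_sum (\<lambda>n. dev n y) N \<partial>unit_interval)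
      \<le> (8 * C1 + 1 + 5 * B + 16 * C2) * real N powr (3 / 2 - a + gap)" if N: "1 \<le> N" for N
  proof -
    let ?N = "real N"
    define K where "K = nat \<lceil>?N powr gap\<rceil>"
    have Ngap: "1 \<le> ?N powr gap" "?N powr gap \<le> ?N"
      using N gap powr_mono[of gap 1 ?N] by (auto intro: ge_one_powr_ge_zero)
    have K: "?N powr gap \<le> K" "K \<le> 2 * ?N powr gap" "K \<le> N"
      using Ngap unfolding K_def by linarith+
    have S1: "(\<Sum>n<N. wt n) \<le> C1 * ?N powr (1 - a)"
      using sum_powr_le'[of a N] a0 a_half by (simp add: wt_def C1_def)
    have sq: "(wt n)\<^sup>2 = real n powr (- (2 * a))" for n
      by (simp add: wt_def power2_eq_square powr_add[symmetric])
    have S2: "(\<Sum>n<N. (wt n)\<^sup>2) \<le> C2 * ?N powr (1 - 2 * a)"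
      unfolding sq using sum_powr_le'[of "2 * a" N] a0 a_half by (simp add: C2_def)
    have "2 powr (?N powr gap) \<le> 2 powr real K" using K by (intro powr_mono) auto
    then have "?N\<^sup>2 / 2 ^ K \<le> ?N\<^sup>2 / 2 powr (?N powr gap)"
      by (intro divide_left_mono) (auto simp: powr_realpow)
    then have "?N\<^sup>2 / 2 ^ K \<le> B * 1" using B[of N] by linarith
    also have "\<dots> \<le> B * ?N powr (1 - 2 * a + gap)"
      using N a_half gap B0 by (intro mult_left_mono ge_one_powr_ge_zero) auto
    finally have e1: "5 * ?N\<^sup>2 / 2 ^ K \<le> 5 * B * ?N powr (1 - 2 * a + gap)" by simp
    have "8 * real K * (\<Sum>n<N. (wt n)\<^sup>2) \<le> 8 * (2 * ?N powr gap) * (C2 * ?N powr (1 - 2 * a))"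
      using K S2 C by (intro mult_mono) (auto intro!: sum_nonneg)
    also have "\<dots> = 16 * C2 * ?N powr (1 - 2 * a + gap)"
      by (simp add: powr_add)
    finally have e2: "8 * real K * (\<Sum>n<N. (wt n)\<^sup>2) \<le> 16 * C2 * ?N powr (1 - 2 * a + gap)" .
    have "(5 * ?N\<^sup>2 / 2 ^ K + 8 * real K * (\<Sum>n<N. (wt n)\<^sup>2)) / ?N powr (1 / 2 - a)
        \<le> ((5 * B + 16 * C2) * ?N powr (1 - 2 * a + gap)) / ?N powr (1 / 2 - a)"
      using e1 e2 by (intro divide_right_mono) (auto simp: algebra_simps)
    also have "\<dots> = (5 * B + 16 * C2) * ?N powr (1 / 2 - a + gap)"
    proof -
      have "(1 - 2 * a + gap) - (1 / 2 - a) = 1 / 2 - a + gap" by simp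
      then show ?thesis by (simp only: times_divide_eq_right[symmetric] powr_diff[symmetric])
    qed
    finally have e3: "?N powr (1 / 2 - a)
          + (5 * ?N\<^sup>2 / 2 ^ K + 8 * real K * (\<Sum>n<N. (wt n)\<^sup>2)) / ?N powr (1 / 2 - a)
        \<le> (1 + 5 * B + 16 * C2) * ?N powr (1 / 2 - a + gap)"
      using powr_mono[of "1 / 2 - a" "1 / 2 - a + gap" ?N] N gap by (simp add: algebra_simps)
    have e4: "4 * real K * (\<Sum>n<N. wt n) \<le> 4 * (2 * ?N powr gap) * (C1 * ?N powr (1 - a))"
      using K S1 C wt_nonneg by (intro mult_mono) (auto intro!: sum_nonneg)
    have e5: "4 * (2 * ?N powr gap) * (C1 * ?N powr (1 - a)) \<le> 8 * C1 * ?N powr (3 / 2 - a + gap)"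
    proof -
      have "4 * (2 * ?N powr gap) * (C1 * ?N powr (1 - a)) = 8 * C1 * ?N powr (1 - a + gap)"
        by (simp add: powr_add)
      also have "\<dots> \<le> 8 * C1 * ?N powr (3 / 2 - a + gap)"
        using C N by (intro mult_left_mono powr_mono) auto
      finally show ?thesis .
    qed
    have e6: "?N * ((1 + 5 * B + 16 * C2) * ?N powr (1 / 2 - a + gap))
        = (1 + 5 * B + 16 * C2) * ?N powr (3 / 2 - a + gap)"
    proof -
      have "?N * ?N powr (1 / 2 - a + gap) = ?N powr 1 * ?N powr (1 / 2 - a + gap)" using N by simp
      also have "\<dots> = ?N powr (3 / 2 - a + gap)"
        by (simp only: powr_add[symmetric]) (simp add: algebra_simps)
      finally show ?thesis by simp
    qed
    have "(\<integral>y. correlation_sum (\<lambda>n. dev n y) N \<partial>unit_interval)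
      \<le> 4 * real K * (\<Sum>n<N. wt n) + ?N * (?N powr (1 / 2 - a)
        + (5 * ?N\<^sup>2 / 2 ^ K + 8 * real K * (\<Sum>n<N. (wt n)\<^sup>2)) / ?N powr (1 / 2 - a))"
      using K N by (intro integral_correlation_sum_le(1)) auto
    also have "\<dots> \<le> 8 * C1 * ?N powr (3 / 2 - a + gap)
        + ?N * ((1 + 5 * B + 16 * C2) * ?N powr (1 / 2 - a + gap))"
      by (rule add_mono[OF order_trans[OF e4 e5] mult_left_mono[OF e3]]) simp
    finally show ?thesis unfolding e6 by (simp add: algebra_simps)
  qed
  then show ?thesis using B0 C by (intro exI[of _ "8 * C1 + 1 + 5 * B + 16 * C2"]) auto
qed

text \<open>The exponent is at least \<open>2 / gap\<close>, so \<open>scale k powr (- gap)\<close>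
  is at most \<open>1 / (k + 1) ^ 2\<close> and summable, while polynomial growth keeps the ratios
  of consecutive terms tending to 1.\<close>

definition scale :: "nat \<Rightarrow> nat" where "scale k = Suc k ^ nat \<lceil>2 / gap\<rceil>"

text \<open>The mean of the numerator is of order at most \<open>N powr (3 / 2 - a + gap)\<close>
  and the denominator at least \<open>N powr (2 - 2 * a) / 4\<close>; their quotient is a constant
  times \<open>N powr (- gap)\<close>.\<close>

lemma AE_summable_correlation_sum:
  "AE y in unit_interval. summable (\<lambda>k. correlation_sum (\<lambda>n. dev n y) (scale k) / (total (scale k))\<^sup>2)"
proof -
  obtain C where C: "C \<ge> 0" and R: "\<And>N. 1 \<le> N \<Longrightarrow>
      (\<integral>y. correlation_sum (\<lambda>n. dev n y) N \<partial>unit_interval) \<le> C * real N powr (3 / 2 - a + gap)"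
    using integral_correlation_sum_power_le by blast
  let ?f = "\<lambda>k y. correlation_sum (\<lambda>n. dev n y) (scale k) / (total (scale k))\<^sup>2"
  have nn: "0 \<le> ?f k y" for k y
    by (auto simp: correlation_sum_def intro!: divide_nonneg_nonneg sum_nonneg)
  have int: "integrable unit_interval (?f k)" for k
    using integral_correlation_sum_le(2)[of 0 "scale k" 1] by simp
  have bound: "(\<integral>y. ?f k y \<partial>unit_interval) \<le> 4 * C * (1 / (real (Suc k))\<^sup>2)" for k
  proof (cases "k = 0")
    case True
    \<comment> \<open>Here \<open>scale 0 = 1\<close> and \<open>total 1 = wt 0 = 0\<close>, so the
      quotient is 0 by the convention for division by zero.\<close>
    then show ?thesis using C by (simp add: scale_def total_def wt_def)
  next
    case False
    let ?N = "real (scale k)" and ?L = "nat \<lceil>2 / gap\<rceil>"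
    have L: "2 \<le> real ?L * gap" "1 \<le> ?L"
    proof -
      have "2 / gap \<le> real ?L" by linarith
      then show "2 \<le> real ?L * gap" using gap(1) by (simp only: pos_divide_le_eq)
      have "0 < 2 / gap" using gap by simp
      then show "1 \<le> ?L" by linarith
    qed
    have "2 \<le> Suc k ^ 1" using False by simp
    also have "\<dots> \<le> scale k" unfolding scale_def using L by (intro power_increasing) auto
    finally have N2: "2 \<le> scale k" .
    have "?N powr (1 - a) / 2 \<le> total (scale k)"
      using sum_powr_ge[OF a0 N2] by (simp add: total_def wt_def)
    then have "(?N powr (1 - a) / 2)\<^sup>2 \<le> (total (scale k))\<^sup>2" by (intro power_mono) auto
    moreover have "(?N powr (1 - a) / 2)\<^sup>2 = ?N powr (2 - 2 * a) / 4"
      by (simp add: power2_eq_square powr_add[symmetric])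
    ultimately have W: "?N powr (2 - 2 * a) / 4 \<le> (total (scale k))\<^sup>2" by simp
    have pos: "0 < ?N powr (2 - 2 * a)" using N2 by simp
    have "(\<integral>y. ?f k y \<partial>unit_interval)
        = (\<integral>y. correlation_sum (\<lambda>n. dev n y) (scale k) \<partial>unit_interval) / (total (scale k))\<^sup>2" by simp
    also have "\<dots> \<le> (C * ?N powr (3 / 2 - a + gap)) / (?N powr (2 - 2 * a) / 4)"
      using R[of "scale k"] N2 W pos C by (intro frac_le) auto
    also have "\<dots> = 4 * C * (?N powr (3 / 2 - a + gap) / ?N powr (2 - 2 * a))" by simp
    also have "\<dots> = 4 * C * ?N powr (- gap)"
    proof -
      have "(3 / 2 - a + gap) - (2 - 2 * a) = - gap" by (simp add: gap_def field_simps)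
      then show ?thesis by (simp only: powr_diff[symmetric])
    qed
    also have "?N powr (- gap) = real (Suc k) powr (- (real ?L * gap))"
      by (simp add: scale_def powr_realpow[symmetric] powr_powr del: of_nat_Suc)
    also have "\<dots> \<le> real (Suc k) powr (- 2)" using L by (intro powr_mono) auto
    also have "\<dots> = 1 / (real (Suc k))\<^sup>2" by (simp add: powr_minus_divide powr_numeral)
    finally show ?thesis using C by (simp add: mult_left_mono)
  qed
  have "summable (\<lambda>k. 1 / (real (Suc k))\<^sup>2)"
    using summable_Suc_iff[of "\<lambda>k. inverse ((real k)\<^sup>2)"] inverse_power_summable[of 2, where 'a = real]
    by (simp add: inverse_eq_divide)
  then have sb: "summable (\<lambda>k. 4 * C * (1 / (real (Suc k))\<^sup>2))" by (rule summable_mult)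
  show ?thesis
  proof (rule AE_summable_of_nn_integral_le[OF _ nn _ sb])
    show "?f k \<in> borel_measurable unit_interval" for k using int by auto
    show "(\<integral>\<^sup>+y. ennreal (?f k y) \<partial>unit_interval) \<le> ennreal (4 * C * (1 / (real (Suc k))\<^sup>2))" for k
      unfolding nn_integral_eq_integral[OF int AE_I2[OF nn]] by (rule ennreal_leI[OF bound])
  qed (use C in auto)
qed

end

section \<open>Sequences and weighted averages\<close>

text \<open>By monotonicity \<open>H n / W n\<close> lies between the quotients of \<open>H\<close>
  and \<open>W\<close> taken at opposite neighbours of \<open>n\<close> in the subsequence. These
  differ from quotients at a single index by the factor \<open>W (N (Suc k)) / W (N k)\<close>,
  which tends to 1.\<close>

lemma tendsto_ratio_of_subsequence:
  fixes H W :: "nat \<Rightarrow> real" and N :: "nat \<Rightarrow> nat"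
  assumes H: "mono H" "\<And>n. 0 \<le> H n" and W: "mono W" and N: "strict_mono N"
    and pos: "\<forall>\<^sub>F k in sequentially. 0 < W (N k)"
    and ratio: "(\<lambda>k. W (N (Suc k)) / W (N k)) \<longlonglongrightarrow> 1"
    and lim: "(\<lambda>k. H (N k) / W (N k)) \<longlonglongrightarrow> L"
  shows "(\<lambda>n. H n / W n) \<longlonglongrightarrow> L"
proof -
  \<comment> \<open>\<open>N (\<kappa> n)\<close> is the last member of the subsequence not
    exceeding \<open>n\<close>; the set is nonempty once \<open>N 0 \<le> n\<close>.\<close>
  define \<kappa> where "\<kappa> n = Max {k. N k \<le> n}" for n
  have fin: "finite {k. N k \<le> n}" for n
  proof (rule finite_subset)
    show "{k. N k \<le> n} \<subseteq> {..n}" using strict_mono_imp_increasing[OF N] by (auto intro: order_trans)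
  qed simp
  have ge: "k \<le> \<kappa> n" if "N k \<le> n" for k n
    unfolding \<kappa>_def using fin that by (intro Max_ge) auto
  have lower: "N (\<kappa> n) \<le> n" if "N 0 \<le> n" for n
    using Max_in[OF fin[of n]] that unfolding \<kappa>_def by blast
  have upper: "n < N (Suc (\<kappa> n))" for n
    using ge[of "Suc (\<kappa> n)" n] by (meson Suc_n_not_le_n not_le)
  have \<kappa>: "filterlim \<kappa> at_top sequentially"
    unfolding filterlim_at_top
  proof
    fix Z show "\<forall>\<^sub>F n in sequentially. Z \<le> \<kappa> n"
      using eventually_ge_at_top[of "N Z"] by eventually_elim (rule ge)
  qed
  have lo: "(\<lambda>k. (H (N k) / W (N k)) / (W (N (Suc k)) / W (N k))) \<longlonglongrightarrow> L / 1"
    using lim ratio by (intro tendsto_divide) auto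
  have hi: "(\<lambda>k. (H (N (Suc k)) / W (N (Suc k))) * (W (N (Suc k)) / W (N k))) \<longlonglongrightarrow> L * 1"
    using filterlim_compose[OF lim filterlim_Suc] ratio by (intro tendsto_mult) auto
  have bounds: "\<forall>\<^sub>F n in sequentially.
      (H (N (\<kappa> n)) / W (N (\<kappa> n))) / (W (N (Suc (\<kappa> n))) / W (N (\<kappa> n))) \<le> H n / W n \<and>
      H n / W n \<le> (H (N (Suc (\<kappa> n))) / W (N (Suc (\<kappa> n)))) * (W (N (Suc (\<kappa> n))) / W (N (\<kappa> n)))"
    using eventually_compose_filterlim[OF pos \<kappa>] eventually_ge_at_top[of "N 0"]
  proof eventually_elim
    case (elim n)
    have le: "W (N (\<kappa> n)) \<le> W n" "W n \<le> W (N (Suc (\<kappa> n)))" "H (N (\<kappa> n)) \<le> H n" "H n \<le> H (N (Suc (\<kappa> n)))"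
      using lower[OF elim(2)] upper[of n] H(1) W by (auto intro: monoD)
    have "H (N (\<kappa> n)) / W (N (Suc (\<kappa> n))) \<le> H n / W n"
      using le elim(1) H(2) by (intro frac_le) auto
    moreover have "H n / W n \<le> H (N (Suc (\<kappa> n))) / W (N (\<kappa> n))"
      using le elim(1) H(2) by (intro frac_le) auto
    ultimately show ?case using le elim(1) by simp
  qed
  show ?thesis
  proof (rule tendsto_sandwich)
    show "(\<lambda>n. (H (N (\<kappa> n)) / W (N (\<kappa> n))) / (W (N (Suc (\<kappa> n))) / W (N (\<kappa> n)))) \<longlonglongrightarrow> L"
      using filterlim_compose[OF lo \<kappa>] by simp
    show "(\<lambda>n. (H (N (Suc (\<kappa> n))) / W (N (Suc (\<kappa> n)))) * (W (N (Suc (\<kappa> n))) / W (N (\<kappa> n)))) \<longlonglongrightarrow> L"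
      using filterlim_compose[OF hi \<kappa>] by simp
  qed (use bounds in \<open>auto elim: eventually_mono\<close>)
qed

text \<open>Abel summation: a decreasing weight only averages the Cesaro means further.\<close>

lemma weighted_sum_le:
  fixes w v :: "nat \<Rightarrow> real"
  assumes w: "\<And>n. 0 \<le> w n" "\<And>n. w (Suc n) \<le> w n"
    and v: "\<And>n. \<bar>\<Sum>i<n. v i\<bar> \<le> e * n + C" and C: "0 \<le> C"
  shows "\<bar>\<Sum>i<n. w i * v i\<bar> \<le> e * (\<Sum>i<n. w i) + C * w 0"
proof (cases n)
  case 0
  then show ?thesis using w C by simp
next
  case (Suc m)
  let ?S = "\<lambda>n. \<Sum>i<n. v i"
  have abel: "(\<Sum>i<Suc m. w i * u i) = w m * (\<Sum>i<Suc m. u i) + (\<Sum>i<m. (w i - w (Suc i)) * (\<Sum>j<Suc i. u j))"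
    for u :: "nat \<Rightarrow> real"
    by (induction m) (simp_all add: algebra_simps)
  have "\<bar>\<Sum>i<Suc m. w i * v i\<bar> \<le> w m * \<bar>?S (Suc m)\<bar> + (\<Sum>i<m. (w i - w (Suc i)) * \<bar>?S (Suc i)\<bar>)"
    unfolding abel using w
    by (intro order_trans[OF abs_triangle_ineq] add_mono order_trans[OF sum_abs] sum_mono)
      (auto simp: abs_mult)
  also have "\<dots> \<le> w m * (e * Suc m + C) + (\<Sum>i<m. (w i - w (Suc i)) * (e * Suc i + C))"
    using w by (intro add_mono sum_mono mult_left_mono v) auto
  \<comment> \<open>Summation by parts for the constant sequence 1, read backwards, recovers the sum
    of the weights, and the differences of \<open>w\<close> telescope to \<open>w 0\<close>.\<close>
  also have "\<dots> = e * (w m * (\<Sum>i<Suc m. 1) + (\<Sum>i<m. (w i - w (Suc i)) * (\<Sum>j<Suc i. 1)))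
      + C * (w m + (\<Sum>i<m. w i - w (Suc i)))"
    by (simp add: algebra_simps sum.distrib sum_distrib_left sum_subtractf)
  also have "\<dots> = e * (\<Sum>i<Suc m. w i) + C * w 0"
    unfolding abel[of "\<lambda>_. 1", symmetric] by (simp add: sum_lessThan_telescope')
  finally show ?thesis using Suc by simp
qed

text \<open>The partial sums of \<open>u - L\<close> are at most \<open>r / 2 * n + C\<close>, which
  \<open>weighted_sum_le\<close> carries over to the weighted sums; the contribution of
  \<open>C\<close> disappears because the total weight is unbounded.\<close>

lemma weighted_average_tendsto:
  fixes w u :: "nat \<Rightarrow> real"
  assumes w: "\<And>n. 0 \<le> w n" "\<And>n. w (Suc n) \<le> w n"
    and W: "filterlim (\<lambda>n. \<Sum>i<n. w i) at_top sequentially"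
    and u: "(\<lambda>n. (\<Sum>i<n. u i) / n) \<longlonglongrightarrow> L"
  shows "(\<lambda>n. (\<Sum>i<n. w i * u i) / (\<Sum>i<n. w i)) \<longlonglongrightarrow> L"
proof (rule LIMSEQ_I)
  fix r :: real assume r: "0 < r"
  define v where "v i = u i - L" for i
  let ?S = "\<lambda>n. \<Sum>i<n. v i"
  obtain n0 where n0: "\<And>n. n \<ge> n0 \<Longrightarrow> norm ((\<Sum>i<n. u i) / n - L) < r / 2"
    using LIMSEQ_D[OF u, of "r / 2"] r by auto
  \<comment> \<open>This absorbs the finitely many partial sums before the means are within
    \<open>r / 2\<close> of \<open>L\<close>.\<close>
  define C where "C = (\<Sum>n\<le>n0. \<bar>?S n\<bar>)"
  have C: "0 \<le> C" unfolding C_def by (intro sum_nonneg) auto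
  have S: "\<bar>?S n\<bar> \<le> r / 2 * n + C" for n
  proof (cases "n \<le> n0")
    case True
    then have "\<bar>?S n\<bar> \<le> C" unfolding C_def by (intro member_le_sum) auto
    then show ?thesis using r by (simp add: add_increasing)
  next
    case False
    then have n: "n \<ge> n0" "n > 0" by auto
    have "?S n = n * ((\<Sum>i<n. u i) / n - L)"
      using n by (simp add: v_def sum_subtractf field_simps)
    then have "\<bar>?S n\<bar> = n * \<bar>(\<Sum>i<n. u i) / n - L\<bar>" by (simp add: abs_mult)
    also have "\<dots> \<le> n * (r / 2)" using n0[OF n(1)] by (intro mult_left_mono) auto
    finally show ?thesis using C by (simp add: mult.commute)
  qed
  \<comment> \<open>Beyond this threshold \<open>C * w 0\<close> is below half of \<open>r\<close>
    times the total weight; the summand 1 makes that weight positive.\<close>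
  have "\<forall>\<^sub>F n in sequentially. 2 * C * w 0 / r + 1 \<le> (\<Sum>i<n. w i)"
    using W unfolding filterlim_at_top by blast
  then have "\<forall>\<^sub>F n in sequentially. norm ((\<Sum>i<n. w i * u i) / (\<Sum>i<n. w i) - L) < r"
  proof eventually_elim
    case (elim n)
    let ?W = "\<Sum>i<n. w i"
    have "0 \<le> 2 * C * w 0 / r" using C r w by simp
    then have W0: "0 < ?W" using elim by linarith
    have "2 * C * w 0 / r < ?W" using elim by linarith
    then have CW: "C * w 0 < r / 2 * ?W" using r by (simp add: field_simps)
    have "(\<Sum>i<n. w i * u i) / ?W - L = (\<Sum>i<n. w i * v i) / ?W"
      using W0 by (simp add: v_def right_diff_distrib sum_subtractf sum_distrib_right[symmetric] sum_distrib_left field_simps)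
    then have "norm ((\<Sum>i<n. w i * u i) / ?W - L) = \<bar>\<Sum>i<n. w i * v i\<bar> / ?W"
      using W0 by simp
    also have "\<dots> \<le> (r / 2 * ?W + C * w 0) / ?W"
      using weighted_sum_le[where w = w and v = v, OF w S C] W0 by (intro divide_right_mono) auto
    also have "\<dots> < r" using CW W0 by (simp add: field_simps)
    finally show ?case .
  qed
  then show "\<exists>no. \<forall>n\<ge>no. norm ((\<Sum>i<n. w i * u i) / (\<Sum>i<n. w i) - L) < r"
    by (simp add: eventually_sequentially)
qed

section \<open>The correlation inequality\<close>

text \<open>Pairs are grouped by their difference \<open>h\<close>. The case \<open>h = 0\<close>
  counts the diagonal twice, which the extra sum on the left compensates.\<close>

lemma square_sum_by_differences:
  fixes b :: "nat \<Rightarrow> nat \<Rightarrow> 'a :: comm_monoid_add"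
  shows "(\<Sum>n<N. \<Sum>m<N. b n m) + (\<Sum>n<N. b n n) = (\<Sum>h<N. \<Sum>n<N - h. b n (n + h) + b (n + h) n)"
proof -
  \<comment> \<open>Raising \<open>N\<close> by one adds, for each difference
    \<open>h \<le> N\<close>, exactly the pair \<open>(N - h, N)\<close>.\<close>
  have tri: "(\<Sum>h<Suc N. \<Sum>n<Suc N - h. g n (n + h))
      = (\<Sum>h<N. \<Sum>n<N - h. g n (n + h)) + (\<Sum>n<Suc N. g n N)" for g :: "nat \<Rightarrow> nat \<Rightarrow> 'a" and N
  proof -
    have "(\<Sum>h<Suc N. \<Sum>n<Suc N - h. g n (n + h)) = (\<Sum>h<Suc N. (\<Sum>n<N - h. g n (n + h)) + g (N - h) N)"
      by (intro sum.cong refl) (auto simp: Suc_diff_le less_Suc_eq_le)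
    also have "\<dots> = (\<Sum>h<N. \<Sum>n<N - h. g n (n + h)) + (\<Sum>h<Suc N. g (Suc N - Suc h) N)"
      by (simp add: sum.distrib ac_simps)
    also have "(\<Sum>h<Suc N. g (Suc N - Suc h) N) = (\<Sum>n<Suc N. g n N)"
      by (rule sum.nat_diff_reindex)
    finally show ?thesis .
  qed
  have "(\<Sum>n<N. \<Sum>m<N. b n m) + (\<Sum>n<N. b n n)
      = (\<Sum>h<N. \<Sum>n<N - h. b n (n + h)) + (\<Sum>h<N. \<Sum>n<N - h. b (n + h) n)"
  proof (induction N)
    case (Suc N)
    have e: "(\<Sum>n<Suc N. \<Sum>m<Suc N. b n m) + (\<Sum>n<Suc N. b n n)
        = ((\<Sum>n<N. \<Sum>m<N. b n m) + (\<Sum>n<N. b n n)) + ((\<Sum>n<Suc N. b n N) + (\<Sum>n<Suc N. b N n))"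
      by (simp add: sum.distrib ac_simps)
    show ?case
      unfolding e Suc.IH tri[of b N] tri[of "\<lambda>n m. b m n" N] by (simp only: ac_simps)
  qed simp
  then show ?thesis by (simp add: sum.distrib)
qed

text \<open>Adding the diagonal once more only increases the form, as \<open>r 0 \<ge> 0\<close>.
  Since \<open>g\<close> depends on the difference of the indices alone, grouping by differences
  pulls \<open>r h\<close> out of the autocorrelation of \<open>c\<close>.\<close>

lemma quadratic_form_le_correlation_sum:
  fixes c r :: "nat \<Rightarrow> real"
  assumes g: "\<And>n m. g n m = g m n" "\<And>n h. g n (n + h) = r h" and r: "0 \<le> r 0" "\<And>h. \<bar>r h\<bar> \<le> B"
  shows "(\<Sum>n<N. \<Sum>m<N. c n * c m * g n m) \<le> correlation_sum c N * B"
proof -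
  have d: "c n * c n * g n n = (c n)\<^sup>2 * r 0" for n
    using g(2)[of n 0] by (simp add: power2_eq_square)
  have "(\<Sum>n<N. \<Sum>m<N. c n * c m * g n m) \<le> (\<Sum>n<N. \<Sum>m<N. c n * c m * g n m) + (\<Sum>n<N. c n * c n * g n n)"
    unfolding d using r(1) by (auto intro!: sum_nonneg)
  also have "\<dots> = (\<Sum>h<N. \<Sum>n<N - h. c n * c (n + h) * g n (n + h) + c (n + h) * c n * g (n + h) n)"
    by (rule square_sum_by_differences)
  also have "\<dots> = (\<Sum>h<N. 2 * ((\<Sum>n<N - h. c n * c (n + h)) * r h))"
  proof (intro sum.cong refl)
    fix h
    have "c n * c (n + h) * g n (n + h) + c (n + h) * c n * g (n + h) n = 2 * (c n * c (n + h) * r h)" for n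
      using g(1)[of "n + h" n] g(2)[of n h] by simp
    then show "(\<Sum>n<N - h. c n * c (n + h) * g n (n + h) + c (n + h) * c n * g (n + h) n)
        = 2 * ((\<Sum>n<N - h. c n * c (n + h)) * r h)"
      by (simp add: sum_distrib_left sum_distrib_right)
  qed
  also have "\<dots> \<le> (\<Sum>h<N. 2 * (\<bar>\<Sum>n<N - h. c n * c (n + h)\<bar> * B))"
  proof (intro sum_mono mult_left_mono)
    fix h
    have "(\<Sum>n<N - h. c n * c (n + h)) * r h \<le> \<bar>\<Sum>n<N - h. c n * c (n + h)\<bar> * \<bar>r h\<bar>"
      by (metis abs_ge_self abs_mult)
    also have "\<dots> \<le> \<bar>\<Sum>n<N - h. c n * c (n + h)\<bar> * B" by (intro mult_left_mono r(2)) auto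
    finally show "(\<Sum>n<N - h. c n * c (n + h)) * r h \<le> \<bar>\<Sum>n<N - h. c n * c (n + h)\<bar> * B" .
  qed simp
  also have "\<dots> = correlation_sum c N * B"
    by (simp add: correlation_sum_def sum_distrib_left sum_distrib_right mult.assoc)
  finally show ?thesis .
qed

text \<open>The case of the constant function 1; it controls the number of elements of the set below
  \<open>N\<close>.\<close>

lemma sum_square_le_correlation_sum: "(\<Sum>n<N. c n)\<^sup>2 \<le> correlation_sum c N"
  using quadratic_form_le_correlation_sum[where g = "\<lambda>_ _. 1" and r = "\<lambda>_. 1" and B = 1 and N = N and c = c]
  by (simp add: power2_eq_square sum_product)

lemma integrable_mult_of_squares:
  fixes f g :: "'a \<Rightarrow> real"
  assumes [measurable]: "f \<in> borel_measurable M" "g \<in> borel_measurable M"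
    and "integrable M (\<lambda>x. (f x)\<^sup>2)" "integrable M (\<lambda>x. (g x)\<^sup>2)"
  shows "integrable M (\<lambda>x. f x * g x)"
proof (rule Bochner_Integration.integrable_bound)
  show "integrable M (\<lambda>x. (f x)\<^sup>2 + (g x)\<^sup>2)" using assms by simp
  have "\<bar>f x * g x\<bar> \<le> (f x)\<^sup>2 + (g x)\<^sup>2" for x
  proof -
    have "0 \<le> (\<bar>f x\<bar> - \<bar>g x\<bar>)\<^sup>2" by simp
    then have "2 * \<bar>f x * g x\<bar> \<le> (f x)\<^sup>2 + (g x)\<^sup>2" by (simp add: power2_diff abs_mult)
    then show ?thesis by linarith
  qed
  then show "AE x in M. norm (f x * g x) \<le> norm ((f x)\<^sup>2 + (g x)\<^sup>2)" by simp
qed measurable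

lemma integrable_diff_square:
  fixes f g :: "'a \<Rightarrow> real"
  assumes "f \<in> borel_measurable M" "g \<in> borel_measurable M"
    and "integrable M (\<lambda>x. (f x)\<^sup>2)" "integrable M (\<lambda>x. (g x)\<^sup>2)"
  shows "integrable M (\<lambda>x. (f x - g x)\<^sup>2)"
  using assms integrable_mult_of_squares[OF assms] by (simp add: power2_diff mult.assoc)

text \<open>Measure preservation makes the inner product of \<open>f (T^n x)\<close> and
  \<open>f (T^(n + h) x)\<close> depend on \<open>h\<close> only, and bounds it by the integral of
  \<open>f ^ 2\<close>. The factor involving \<open>c\<close> is thus the same for all
  systems.\<close>

lemma (in measure_preserving_system) integral_weighted_sum_square_le:
  fixes f :: "'x \<Rightarrow> real"
  assumes f[measurable]: "f \<in> borel_measurable M" and f2: "integrable M (\<lambda>x. (f x)\<^sup>2)"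
  shows "integrable M (\<lambda>x. (\<Sum>n<N. c n * f ((T ^^ n) x))\<^sup>2)"
    and "(\<integral>x. (\<Sum>n<N. c n * f ((T ^^ n) x))\<^sup>2 \<partial>M) \<le> correlation_sum c N * (\<integral>x. (f x)\<^sup>2 \<partial>M)"
proof -
  let ?g = "\<lambda>n m. \<integral>x. f ((T ^^ n) x) * f ((T ^^ m) x) \<partial>M"
  let ?r = "\<lambda>h. \<integral>x. f x * f ((T ^^ h) x) \<partial>M"
  have fm[measurable]: "(\<lambda>x. f ((T ^^ n) x)) \<in> borel_measurable M" for n
    by (rule measurable_funpow_apply[OF f])
  have f2n: "integrable M (\<lambda>x. (f ((T ^^ n) x))\<^sup>2)" "(\<integral>x. (f ((T ^^ n) x))\<^sup>2 \<partial>M) = (\<integral>x. (f x)\<^sup>2 \<partial>M)" for n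
    using f2 integrable_funpow_iff[of "\<lambda>x. (f x)\<^sup>2" n] integral_funpow[of "\<lambda>x. (f x)\<^sup>2" n] by auto
  have i: "integrable M (\<lambda>x. f ((T ^^ n) x) * f ((T ^^ m) x))" for n m
    by (intro integrable_mult_of_squares fm f2n)
  have expand: "(\<Sum>n<N. c n * f ((T ^^ n) x))\<^sup>2
      = (\<Sum>n<N. \<Sum>m<N. c n * c m * (f ((T ^^ n) x) * f ((T ^^ m) x)))" for x
    by (simp add: power2_eq_square sum_product ac_simps)
  show "integrable M (\<lambda>x. (\<Sum>n<N. c n * f ((T ^^ n) x))\<^sup>2)"
    unfolding expand using i by (intro Bochner_Integration.integrable_sum integrable_mult_right)
  have "(\<integral>x. (\<Sum>n<N. c n * f ((T ^^ n) x))\<^sup>2 \<partial>M) = (\<Sum>n<N. \<Sum>m<N. c n * c m * ?g n m)"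
    unfolding expand using i by (simp add: Bochner_Integration.integral_sum)
  also have "\<dots> \<le> correlation_sum c N * (\<integral>x. (f x)\<^sup>2 \<partial>M)"
  proof (rule quadratic_form_le_correlation_sum)
    show "?g n m = ?g m n" for n m by (simp add: mult.commute)
    show "?g n (n + h) = ?r h" for n h
    proof -
      have "(T ^^ (n + h)) x = (T ^^ h) ((T ^^ n) x)" for x
        by (metis add.commute comp_apply funpow_add)
      then show ?thesis using integral_funpow[of "\<lambda>x. f x * f ((T ^^ h) x)" n] by simp
    qed
    show "0 \<le> ?r 0" by simp
    show "\<bar>?r h\<bar> \<le> (\<integral>x. (f x)\<^sup>2 \<partial>M)" for h
    proof -
      have "\<bar>?r h\<bar> \<le> (\<integral>x. \<bar>f x * f ((T ^^ h) x)\<bar> \<partial>M)" by (rule integral_abs_bound)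
      also have "\<dots> \<le> (\<integral>x. ((f x)\<^sup>2 + (f ((T ^^ h) x))\<^sup>2) / 2 \<partial>M)"
      proof (rule integral_mono)
        show "integrable M (\<lambda>x. \<bar>f x * f ((T ^^ h) x)\<bar>)" using i[of 0 h] by simp
        show "integrable M (\<lambda>x. ((f x)\<^sup>2 + (f ((T ^^ h) x))\<^sup>2) / 2)" using f2 f2n by simp
        fix x
        have "0 \<le> (\<bar>f x\<bar> - \<bar>f ((T ^^ h) x)\<bar>)\<^sup>2" by simp
        then show "\<bar>f x * f ((T ^^ h) x)\<bar> \<le> ((f x)\<^sup>2 + (f ((T ^^ h) x))\<^sup>2) / 2"
          by (simp add: power2_diff abs_mult)
      qed
      also have "\<dots> = (\<integral>x. (f x)\<^sup>2 \<partial>M)" using f2 f2n by simp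
      finally show ?thesis .
    qed
  qed
  finally show "(\<integral>x. (\<Sum>n<N. c n * f ((T ^^ n) x))\<^sup>2 \<partial>M) \<le> correlation_sum c N * (\<integral>x. (f x)\<^sup>2 \<partial>M)" .
qed

section \<open>Ergodic averages along a sparse set\<close>

text \<open>All that is kept of the random choice of \<open>y\<close> is the summability condition
  on \<open>S\<close>. It mentions neither a system nor a function, which is why the exceptional set
  of \<open>y\<close> is universal.\<close>

locale sparse_set =
  fixes w :: "nat \<Rightarrow> real" and S :: "nat set" and N :: "nat \<Rightarrow> nat"
  assumes w_nonneg: "\<And>n. 0 \<le> w n" and w_0: "w 0 = 0"
    and w_antimono: "\<And>m n. 1 \<le> m \<Longrightarrow> m \<le> n \<Longrightarrow> w n \<le> w m"
    and total_at_top: "filterlim (\<lambda>n. \<Sum>i<n. w i) at_top sequentially"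
    and strict_mono_N: "strict_mono N"
    and total_ratio: "(\<lambda>k. (\<Sum>i<N (Suc k). w i) / (\<Sum>i<N k. w i)) \<longlonglongrightarrow> 1"
    and summable_correlation_sum:
      "summable (\<lambda>k. correlation_sum (\<lambda>n. of_bool (n \<in> S) - w n) (N k) / (\<Sum>i<N k. w i)\<^sup>2)"
begin

abbreviation total :: "nat \<Rightarrow> real" where "total n \<equiv> (\<Sum>i<n. w i)"

abbreviation hits :: "nat \<Rightarrow> real" where "hits n \<equiv> (\<Sum>i<n. of_bool (i \<in> S))"

abbreviation dev :: "nat \<Rightarrow> real" where "dev n \<equiv> of_bool (n \<in> S) - w n"

lemma mono_total: "mono total"
  by (intro monoI sum_mono2) (auto simp: w_nonneg)

lemma eventually_total_pos: "\<forall>\<^sub>F n in sequentially. 0 < total n"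
  using total_at_top by (simp add: filterlim_at_top_dense)

lemma filterlim_N: "filterlim N at_top sequentially"
  by (rule filterlim_subseq[OF strict_mono_N])

lemma eventually_total_N_pos: "\<forall>\<^sub>F k in sequentially. 0 < total (N k)"
  by (rule eventually_compose_filterlim[OF eventually_total_pos filterlim_N])

text \<open>Along \<open>N\<close> the square of the difference of the two counts is at most the
  correlation sum, which is negligible against the square of \<open>total\<close>; monotonicity
  fills the gaps.\<close>

lemma tendsto_hits_total: "(\<lambda>n. hits n / total n) \<longlonglongrightarrow> 1"
proof (rule tendsto_ratio_of_subsequence[OF _ _ mono_total strict_mono_N eventually_total_N_pos total_ratio])
  show "mono hits" by (intro monoI sum_mono2) auto
  show "0 \<le> hits n" for n by (intro sum_nonneg) auto
  have "(\<lambda>k. ((\<Sum>n<N k. dev n) / total (N k))\<^sup>2) \<longlonglongrightarrow> 0"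
  proof (rule tendsto_sandwich[of "\<lambda>_. 0"])
    show "(\<lambda>k. correlation_sum dev (N k) / (total (N k))\<^sup>2) \<longlonglongrightarrow> 0"
      by (rule summable_LIMSEQ_zero[OF summable_correlation_sum])
    show "\<forall>\<^sub>F k in sequentially. ((\<Sum>n<N k. dev n) / total (N k))\<^sup>2
        \<le> correlation_sum dev (N k) / (total (N k))\<^sup>2"
      unfolding power_divide by (intro always_eventually allI divide_right_mono sum_square_le_correlation_sum) auto
  qed auto
  then have "(\<lambda>k. (\<Sum>n<N k. dev n) / total (N k)) \<longlonglongrightarrow> 0"
    by (simp add: power_tendsto_0_iff)
  then have "(\<lambda>k. (\<Sum>n<N k. dev n) / total (N k) + 1) \<longlonglongrightarrow> 0 + 1" by (intro tendsto_intros)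
  moreover have "\<forall>\<^sub>F k in sequentially. (\<Sum>n<N k. dev n) / total (N k) + 1 = hits (N k) / total (N k)"
    using eventually_total_N_pos by eventually_elim (simp add: sum_subtractf diff_divide_distrib)
  ultimately have "(\<lambda>k. hits (N k) / total (N k)) \<longlonglongrightarrow> 0 + 1"
    by (rule Lim_transform_eventually)
  then show "(\<lambda>k. hits (N k) / total (N k)) \<longlonglongrightarrow> 1" by simp
qed

text \<open>The counting function is asymptotic to \<open>total\<close>, which is unbounded.\<close>

lemma infinite_S: "infinite S"
proof
  assume fin: "finite S"
  have "filterlim (\<lambda>n. hits n / total n * total n) at_top sequentially"
    by (rule filterlim_tendsto_pos_mult_at_top[OF tendsto_hits_total _ total_at_top]) simp
  then have "\<forall>\<^sub>F n in sequentially. real (card S) < hits n / total n * total n"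
    unfolding filterlim_at_top_dense by blast
  then have "\<forall>\<^sub>F n in sequentially. real (card S) < hits n"
    using eventually_total_pos by eventually_elim simp
  then obtain n where "real (card S) < hits n"
    using eventually_happens'[OF sequentially_bot] by blast
  moreover have "hits n = card ({..<n} \<inter> S)" by (simp add: sum_of_bool_eq)
  moreover have "card ({..<n} \<inter> S) \<le> card S" using fin by (intro card_mono) auto
  ultimately show False by simp
qed

text \<open>The weights decrease only from index 1 on, so Birkhoff's theorem is used at
  \<open>T x\<close> with the shifted weights. Nothing is lost, as \<open>w 0 = 0\<close>, and the
  limit at \<open>T x\<close> is that at \<open>x\<close> by invariance.\<close>

lemma AE_tendsto_weighted_average:
  assumes "measure_preserving_system M T" and f: "integrable M (f :: 'x \<Rightarrow> real)"
  shows "AE x in M. (\<lambda>n. (\<Sum>i<n. w i * f ((T ^^ i) x)) / total n)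
    \<longlonglongrightarrow> real_cond_exp M (invariant_algebra M T) f x"
proof -
  interpret measure_preserving_system M T by fact
  let ?E = "real_cond_exp M (invariant_algebra M T) f"
  have "AE x in M. (\<lambda>n. (\<Sum>i<n. f ((T ^^ i) ((T ^^ 1) x))) / n) \<longlonglongrightarrow> ?E ((T ^^ 1) x)"
    by (rule AE_funpow[OF AE_Birkhoff[OF f]])
  then show ?thesis using AE_cond_exp_invariant[of f]
  proof eventually_elim
    case (elim x)
    let ?w = "\<lambda>n. w (Suc n)"
    have shift: "(\<Sum>i<Suc n. w i * u i) = (\<Sum>i<n. ?w i * u (Suc i))" for n and u :: "nat \<Rightarrow> real"
      by (simp add: sum.lessThan_Suc_shift w_0 del: sum.lessThan_Suc)
    have shift1: "total (Suc n) = (\<Sum>i<n. ?w i)" for n using shift[of "\<lambda>_. 1" n] by simp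
    have "(\<lambda>n. (\<Sum>i<n. f ((T ^^ Suc i) x)) / n) \<longlonglongrightarrow> ?E x"
      using elim(1) elim(2)[rule_format, of 1] by (simp add: funpow_swap1)
    then have "(\<lambda>n. (\<Sum>i<n. ?w i * f ((T ^^ Suc i) x)) / (\<Sum>i<n. ?w i)) \<longlonglongrightarrow> ?E x"
    proof (rule weighted_average_tendsto[rotated 3])
      show "filterlim (\<lambda>n. \<Sum>i<n. ?w i) at_top sequentially"
        unfolding shift1[symmetric] by (rule filterlim_compose[OF total_at_top filterlim_Suc])
    qed (auto intro: w_nonneg w_antimono)
    then have "(\<lambda>n. (\<Sum>i<Suc n. w i * f ((T ^^ i) x)) / total (Suc n)) \<longlonglongrightarrow> ?E x"
      by (simp only: shift shift1)
    then show ?case by (rule LIMSEQ_imp_Suc)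
  qed
qed

text \<open>Split the indicator of \<open>S\<close> into \<open>dev\<close> and \<open>w\<close>.
  The squared \<open>dev\<close> averages along \<open>N\<close> have summable integrals, so these
  averages tend to 0 almost everywhere. Since \<open>f \<ge> 0\<close> makes the sums monotone,
  convergence along \<open>N\<close> implies convergence.\<close>

lemma AE_tendsto_average_nonneg:
  assumes "measure_preserving_system M T"
    and f[measurable]: "(f :: 'x \<Rightarrow> real) \<in> borel_measurable M"
    and f2: "integrable M (\<lambda>x. (f x)\<^sup>2)" and nn: "\<And>x. 0 \<le> f x"
  shows "AE x in M. (\<lambda>n. (\<Sum>i<n. of_bool (i \<in> S) * f ((T ^^ i) x)) / total n)
    \<longlonglongrightarrow> real_cond_exp M (invariant_algebra M T) f x"
proof -
  interpret measure_preserving_system M T by fact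
  let ?E = "real_cond_exp M (invariant_algebra M T) f"
  let ?D = "\<lambda>k x. ((\<Sum>i<N k. dev i * f ((T ^^ i) x)) / total (N k))\<^sup>2"
  have int: "integrable M (?D k)" for k
    unfolding power_divide by (intro integrable_divide integral_weighted_sum_square_le(1) f f2)
  have "AE x in M. summable (\<lambda>k. ?D k x)"
  proof (rule AE_summable_of_nn_integral_le)
    let ?b = "\<lambda>k. correlation_sum dev (N k) / (total (N k))\<^sup>2 * (\<integral>x. (f x)\<^sup>2 \<partial>M)"
    show "?D k \<in> borel_measurable M" for k using int[of k] by auto
    show "summable ?b" by (rule summable_mult2[OF summable_correlation_sum])
    show "0 \<le> ?b k" for k
      by (auto simp: correlation_sum_def intro!: mult_nonneg_nonneg divide_nonneg_nonneg sum_nonneg)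
    show "(\<integral>\<^sup>+x. ennreal (?D k x) \<partial>M) \<le> ennreal (?b k)" for k
    proof -
      have "(\<integral>\<^sup>+x. ennreal (?D k x) \<partial>M) = ennreal (\<integral>x. ?D k x \<partial>M)"
        by (rule nn_integral_eq_integral[OF int]) simp
      also have "(\<integral>x. ?D k x \<partial>M) = (\<integral>x. (\<Sum>i<N k. dev i * f ((T ^^ i) x))\<^sup>2 \<partial>M) / (total (N k))\<^sup>2"
        unfolding power_divide by simp
      also have "\<dots> \<le> correlation_sum dev (N k) * (\<integral>x. (f x)\<^sup>2 \<partial>M) / (total (N k))\<^sup>2"
        by (intro divide_right_mono integral_weighted_sum_square_le(2) f f2) simp
      finally show ?thesis by (simp add: ennreal_leI)
    qed
  qed simp
  moreover have "AE x in M. (\<lambda>n. (\<Sum>i<n. w i * f ((T ^^ i) x)) / total n) \<longlonglongrightarrow> ?E x"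
    using assms(1) square_integrable_imp_integrable[OF f f2] by (rule AE_tendsto_weighted_average)
  ultimately show ?thesis
  proof eventually_elim
    case (elim x)
    have "(\<lambda>k. (\<Sum>i<N k. dev i * f ((T ^^ i) x)) / total (N k)) \<longlonglongrightarrow> 0"
      using summable_LIMSEQ_zero[OF elim(1)] by (simp add: power_tendsto_0_iff)
    moreover have "(\<lambda>k. (\<Sum>i<N k. w i * f ((T ^^ i) x)) / total (N k)) \<longlonglongrightarrow> ?E x"
      by (rule filterlim_compose[OF elim(2) filterlim_N])
    ultimately have "(\<lambda>k. (\<Sum>i<N k. dev i * f ((T ^^ i) x)) / total (N k)
        + (\<Sum>i<N k. w i * f ((T ^^ i) x)) / total (N k)) \<longlonglongrightarrow> 0 + ?E x"
      by (rule tendsto_add)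
    then have lim: "(\<lambda>k. (\<Sum>i<N k. of_bool (i \<in> S) * f ((T ^^ i) x)) / total (N k)) \<longlonglongrightarrow> ?E x"
      by (simp add: add_divide_distrib[symmetric] sum.distrib[symmetric] left_diff_distrib)
    show ?case
    proof (rule tendsto_ratio_of_subsequence[OF _ _ mono_total strict_mono_N eventually_total_N_pos total_ratio lim])
      show "mono (\<lambda>n. \<Sum>i<n. of_bool (i \<in> S) * f ((T ^^ i) x))"
        using nn by (intro monoI sum_mono2) auto
      show "0 \<le> (\<Sum>i<n. of_bool (i \<in> S) * f ((T ^^ i) x))" for n
        using nn by (intro sum_nonneg) auto
    qed
  qed
qed

section \<open>From weighted averages to averages along the enumeration\<close>

lemma filterlim_enumerate: "filterlim (enumerate S) at_top sequentially"
  using infinite_S by (intro filterlim_subseq) (simp add: strict_mono_def)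

text \<open>The elements of \<open>S\<close> below \<open>enumerate S n\<close> are exactly the
  first \<open>n\<close>, counted from index 0.\<close>

lemma sum_enumerate:
  fixes u :: "nat \<Rightarrow> real"
  shows "(\<Sum>i<enumerate S n. of_bool (i \<in> S) * u i) = (\<Sum>j<n. u (enumerate S j))"
proof -
  have "{..<enumerate S n} \<inter> S = enumerate S ` {..<n}"
  proof (intro equalityI subsetI)
    fix i assume i: "i \<in> {..<enumerate S n} \<inter> S"
    then obtain j where "i = enumerate S j" using enumerate_Ex[of S i] infinite_S by auto
    then show "i \<in> enumerate S ` {..<n}" using i infinite_S by auto
  qed (use infinite_S enumerate_in_set in auto)
  moreover have "(\<Sum>i<enumerate S n. of_bool (i \<in> S) * u i) = (\<Sum>i\<in>{..<enumerate S n} \<inter> S. u i)"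
    by (rule sum.mono_neutral_cong_right) auto
  moreover have "(\<Sum>i\<in>enumerate S ` {..<n}. u i) = (\<Sum>j<n. u (enumerate S j))"
    using inj_enumerate[OF infinite_S] by (subst sum.reindex) (auto intro: inj_on_subset)
  ultimately show ?thesis by simp
qed

text \<open>Positive and negative parts reduce to the nonnegative case, and \<open>total\<close> may
  be replaced by the asymptotically equal \<open>hits\<close>.\<close>

theorem AE_tendsto_average_enumerate:
  assumes "measure_preserving_system M T"
    and f[measurable]: "(f :: 'x \<Rightarrow> real) \<in> borel_measurable M"
    and f2: "integrable M (\<lambda>x. (f x)\<^sup>2)"
  shows "AE x in M. (\<lambda>n. (\<Sum>j<n. f ((T ^^ enumerate S j) x)) / n)
    \<longlonglongrightarrow> real_cond_exp M (invariant_algebra M T) f x"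
proof -
  interpret measure_preserving_system M T by fact
  let ?E = "real_cond_exp M (invariant_algebra M T)"
  let ?p = "\<lambda>x. max 0 (f x)" and ?m = "\<lambda>x. max 0 (- f x)"
  have pm: "integrable M (\<lambda>x. (?p x)\<^sup>2)" "integrable M (\<lambda>x. (?m x)\<^sup>2)"
    by (rule Bochner_Integration.integrable_bound[OF f2]; auto simp: max_def)+
  have ipm: "integrable M ?p" "integrable M ?m"
    by (rule square_integrable_imp_integrable[OF _ pm(1)] square_integrable_imp_integrable[OF _ pm(2)]; simp)+
  have "AE x in M. ?E (\<lambda>x. ?p x - ?m x) x = ?E ?p x - ?E ?m x"
    by (rule inv.real_cond_exp_diff[OF ipm])
  moreover have "(\<lambda>x. ?p x - ?m x) = f" by (auto simp: max_def fun_eq_iff)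
  ultimately have "AE x in M. ?E f x = ?E ?p x - ?E ?m x" by simp
  moreover have "AE x in M. (\<lambda>n. (\<Sum>i<n. of_bool (i \<in> S) * ?p ((T ^^ i) x)) / total n) \<longlonglongrightarrow> ?E ?p x"
    by (rule AE_tendsto_average_nonneg[OF assms(1) _ pm(1)]) auto
  moreover have "AE x in M. (\<lambda>n. (\<Sum>i<n. of_bool (i \<in> S) * ?m ((T ^^ i) x)) / total n) \<longlonglongrightarrow> ?E ?m x"
    by (rule AE_tendsto_average_nonneg[OF assms(1) _ pm(2)]) auto
  ultimately show ?thesis
  proof eventually_elim
    case (elim x)
    have pt: "?p z - ?m z = f z" for z by (auto simp: max_def)
    have "(\<lambda>n. (\<Sum>i<n. of_bool (i \<in> S) * ?p ((T ^^ i) x)) / total n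
        - (\<Sum>i<n. of_bool (i \<in> S) * ?m ((T ^^ i) x)) / total n) \<longlonglongrightarrow> ?E ?p x - ?E ?m x"
      by (rule tendsto_diff[OF elim(2,3)])
    then have "(\<lambda>n. (\<Sum>i<n. of_bool (i \<in> S) * f ((T ^^ i) x)) / total n) \<longlonglongrightarrow> ?E f x"
      unfolding diff_divide_distrib[symmetric] sum_subtractf[symmetric] right_diff_distrib[symmetric] pt elim(1) .
    then have "(\<lambda>n. ((\<Sum>i<n. of_bool (i \<in> S) * f ((T ^^ i) x)) / total n) / (hits n / total n)) \<longlonglongrightarrow> ?E f x / 1"
      using tendsto_hits_total by (rule tendsto_divide) simp
    moreover have "\<forall>\<^sub>F n in sequentially.
        ((\<Sum>i<n. of_bool (i \<in> S) * f ((T ^^ i) x)) / total n) / (hits n / total n)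
          = (\<Sum>i<n. of_bool (i \<in> S) * f ((T ^^ i) x)) / hits n"
      using eventually_total_pos by eventually_elim simp
    ultimately have "(\<lambda>n. (\<Sum>i<n. of_bool (i \<in> S) * f ((T ^^ i) x)) / hits n) \<longlonglongrightarrow> ?E f x / 1"
      by (rule Lim_transform_eventually)
    then have "(\<lambda>n. (\<Sum>i<n. of_bool (i \<in> S) * f ((T ^^ i) x)) / hits n) \<longlonglongrightarrow> ?E f x" by simp
    \<comment> \<open>At \<open>enumerate S n\<close> the count \<open>hits\<close> equals
      \<open>n\<close>.\<close>
    from filterlim_compose[OF this filterlim_enumerate]
    show ?case using sum_enumerate[of "\<lambda>_. 1"] by (simp add: sum_enumerate)
  qed
qed

end

section \<open>Mean convergence\<close>

context measure_preserving_system
begin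

text \<open>By convexity of the square and measure preservation, averaging along any sequence is a
  contraction of the square norm.\<close>

lemma integral_average_square_le:
  fixes f :: "'x \<Rightarrow> real" and s :: "nat \<Rightarrow> nat"
  assumes f[measurable]: "f \<in> borel_measurable M" and f2: "integrable M (\<lambda>x. (f x)\<^sup>2)"
  shows "integrable M (\<lambda>x. ((\<Sum>j<n. f ((T ^^ s j) x)) / n)\<^sup>2)"
    and "(\<integral>x. ((\<Sum>j<n. f ((T ^^ s j) x)) / n)\<^sup>2 \<partial>M) \<le> (\<integral>x. (f x)\<^sup>2 \<partial>M)"
proof -
  have fm[measurable]: "(\<lambda>x. f ((T ^^ j) x)) \<in> borel_measurable M" for j
    by (rule measurable_funpow_apply[OF f])
  have f2n: "integrable M (\<lambda>x. (f ((T ^^ j) x))\<^sup>2)" "(\<integral>x. (f ((T ^^ j) x))\<^sup>2 \<partial>M) = (\<integral>x. (f x)\<^sup>2 \<partial>M)" for j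
    using f2 integrable_funpow_iff[of "\<lambda>x. (f x)\<^sup>2" j] integral_funpow[of "\<lambda>x. (f x)\<^sup>2" j] by auto
  have pt: "((\<Sum>j<n. f ((T ^^ s j) x)) / n)\<^sup>2 \<le> (\<Sum>j<n. (f ((T ^^ s j) x))\<^sup>2) / n" for x
  proof (cases "n = 0")
    case False
    have "(\<Sum>j<n. f ((T ^^ s j) x))\<^sup>2 \<le> (\<Sum>j<n. (f ((T ^^ s j) x))\<^sup>2) * n"
      using sum_squared_le_sum_of_squares[of "\<lambda>j. f ((T ^^ s j) x)" "{..<n}"] by simp
    then have "(\<Sum>j<n. f ((T ^^ s j) x))\<^sup>2 / (real n)\<^sup>2 \<le> (\<Sum>j<n. (f ((T ^^ s j) x))\<^sup>2) * n / (real n)\<^sup>2"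
      by (rule divide_right_mono) simp
    then show ?thesis using False by (simp add: power_divide power2_eq_square)
  qed simp
  have ib: "integrable M (\<lambda>x. (\<Sum>j<n. (f ((T ^^ s j) x))\<^sup>2) / n)"
    using f2n by (intro integrable_divide Bochner_Integration.integrable_sum)
  show i: "integrable M (\<lambda>x. ((\<Sum>j<n. f ((T ^^ s j) x)) / n)\<^sup>2)"
    by (rule Bochner_Integration.integrable_bound[OF ib])
      (use pt in \<open>auto intro!: AE_I2 order_trans[OF pt] simp: sum_nonneg\<close>)
  have "(\<integral>x. ((\<Sum>j<n. f ((T ^^ s j) x)) / n)\<^sup>2 \<partial>M) \<le> (\<integral>x. (\<Sum>j<n. (f ((T ^^ s j) x))\<^sup>2) / n \<partial>M)"
    by (rule integral_mono[OF i ib pt])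
  also have "\<dots> = (\<Sum>j<n. \<integral>x. (f x)\<^sup>2 \<partial>M) / n"
    using f2n by (simp add: Bochner_Integration.integral_sum)
  also have "\<dots> \<le> (\<integral>x. (f x)\<^sup>2 \<partial>M)" by simp
  finally show "(\<integral>x. ((\<Sum>j<n. f ((T ^^ s j) x)) / n)\<^sup>2 \<partial>M) \<le> (\<integral>x. (f x)\<^sup>2 \<partial>M)" .
qed

lemma integral_cond_exp_square_le:
  fixes f :: "'x \<Rightarrow> real"
  assumes f[measurable]: "f \<in> borel_measurable M" and f2: "integrable M (\<lambda>x. (f x)\<^sup>2)"
  shows "integrable M (\<lambda>x. (real_cond_exp M (invariant_algebra M T) f x)\<^sup>2)"
    and "(\<integral>x. (real_cond_exp M (invariant_algebra M T) f x)\<^sup>2 \<partial>M) \<le> (\<integral>x. (f x)\<^sup>2 \<partial>M)"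
proof -
  let ?E = "real_cond_exp M (invariant_algebra M T)"
  have jensen: "AE x in M. (?E f x)\<^sup>2 \<le> ?E (\<lambda>x. (f x)\<^sup>2) x"
    by (rule inv.real_cond_exp_jensens_inequality(2)[where I = UNIV and q = power2])
      (use square_integrable_imp_integrable[OF f f2] f2 convex_power2 in auto)
  have iE: "integrable M (?E (\<lambda>x. (f x)\<^sup>2))" "(\<integral>x. ?E (\<lambda>x. (f x)\<^sup>2) x \<partial>M) = (\<integral>x. (f x)\<^sup>2 \<partial>M)"
    using inv.real_cond_exp_int[OF f2] by auto
  show i: "integrable M (\<lambda>x. (?E f x)\<^sup>2)"
    by (rule Bochner_Integration.integrable_bound[OF iE(1)])
      (use jensen in \<open>auto intro: order_trans[OF _ abs_ge_self]\<close>)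
  show "(\<integral>x. (?E f x)\<^sup>2 \<partial>M) \<le> (\<integral>x. (f x)\<^sup>2 \<partial>M)"
    using integral_mono_AE[OF i iE(1) jensen] iE(2) by simp
qed

text \<open>Write \<open>f\<close> as a bounded truncation plus a remainder \<open>g\<close> of
  small square norm. For the truncation dominated convergence applies; for \<open>g\<close> the
  averages and the conditional expectation are both contractions, so its contribution is small
  uniformly in \<open>n\<close>.\<close>

lemma tendsto_integral_square_of_AE_tendsto:
  fixes f :: "'x \<Rightarrow> real" and s :: "nat \<Rightarrow> nat"
  assumes AE: "\<And>g :: 'x \<Rightarrow> real. g \<in> borel_measurable M \<Longrightarrow> integrable M (\<lambda>x. (g x)\<^sup>2) \<Longrightarrow>
      AE x in M. (\<lambda>n. (\<Sum>j<n. g ((T ^^ s j) x)) / n) \<longlonglongrightarrow> real_cond_exp M (invariant_algebra M T) g x"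
    and f[measurable]: "f \<in> borel_measurable M" and f2: "integrable M (\<lambda>x. (f x)\<^sup>2)"
  shows "(\<lambda>n. \<integral>x. ((\<Sum>j<n. f ((T ^^ s j) x)) / n - real_cond_exp M (invariant_algebra M T) f x)\<^sup>2 \<partial>M)
    \<longlonglongrightarrow> 0"
proof (rule LIMSEQ_I)
  fix r :: real assume r: "0 < r"
  let ?E = "real_cond_exp M (invariant_algebra M T)"
  let ?A = "\<lambda>g n x. (\<Sum>j<n. g ((T ^^ s j) x)) / real n"
  define t where "t K x = max (- real K) (min (real K) (f x))" for K x
  have tm[measurable]: "t K \<in> borel_measurable M" for K unfolding t_def by measurable
  have tK: "\<bar>t K x\<bar> \<le> real K" for K x by (auto simp: t_def)
  have t2: "integrable M (\<lambda>x. (t K x)\<^sup>2)" for K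
  proof (rule Bochner_Integration.integrable_bound[OF f2])
    show "AE x in M. norm ((t K x)\<^sup>2) \<le> norm ((f x)\<^sup>2)"
      by (intro AE_I2) (auto simp: t_def abs_le_square_iff[symmetric] max_def min_def)
  qed simp
  have "(\<lambda>K. \<integral>x. (f x - t K x)\<^sup>2 \<partial>M) \<longlonglongrightarrow> (\<integral>x. 0 \<partial>M)"
  proof (rule integral_dominated_convergence)
    show "integrable M (\<lambda>x. (f x)\<^sup>2)" by (rule f2)
    show "AE x in M. norm ((f x - t K x)\<^sup>2) \<le> (f x)\<^sup>2" for K
      by (intro AE_I2) (auto simp: t_def abs_le_square_iff[symmetric] max_def min_def)
    show "AE x in M. (\<lambda>K. (f x - t K x)\<^sup>2) \<longlonglongrightarrow> 0"
    proof (rule AE_I2)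
      fix x
      obtain K0 :: nat where "\<bar>f x\<bar> < K0" using reals_Archimedean2 by blast
      then have "t K x = f x" if "K \<ge> K0" for K using that by (auto simp: t_def)
      then have "\<forall>\<^sub>F K in sequentially. (f x - t K x)\<^sup>2 = 0"
        unfolding eventually_sequentially by (intro exI[of _ K0]) auto
      then show "(\<lambda>K. (f x - t K x)\<^sup>2) \<longlonglongrightarrow> 0" by (rule tendsto_eventually)
    qed
  qed measurable
  \<comment> \<open>The squared error is split into three parts, each with the factor 3, hence the
    ninth.\<close>
  then obtain K where K: "(\<integral>x. (f x - t K x)\<^sup>2 \<partial>M) < r / 9"
    using LIMSEQ_D[of _ 0 "r / 9"] r by fastforce
  define g where "g x = f x - t K x" for x
  have gm[measurable]: "g \<in> borel_measurable M" unfolding g_def by measurable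
  have g2: "integrable M (\<lambda>x. (g x)\<^sup>2)" unfolding g_def by (intro integrable_diff_square f f2 tm t2)
  have tn[measurable]: "(\<lambda>x. t K ((T ^^ j) x)) \<in> borel_measurable M" for j
    by (rule measurable_funpow_apply[OF tm])
  have tA: "\<bar>?A (t K) n x\<bar> \<le> real K" for n x
  proof (cases "n = 0")
    case False
    have "\<bar>\<Sum>j<n. t K ((T ^^ s j) x)\<bar> \<le> (\<Sum>j<n. real K)"
      by (rule order_trans[OF sum_abs sum_mono]) (rule tK)
    then show ?thesis using False by (simp add: field_simps)
  qed simp
  have tlim: "AE x in M. (\<lambda>n. ?A (t K) n x) \<longlonglongrightarrow> ?E (t K) x" by (rule AE[OF tm t2])
  \<comment> \<open>The bound on the averages passes to their almost everywhere limit, the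
    conditional expectation.\<close>
  then have tE: "AE x in M. \<bar>?E (t K) x\<bar> \<le> real K"
  proof eventually_elim
    case (elim x)
    show ?case by (rule LIMSEQ_le_const2[OF tendsto_rabs[OF elim]]) (use tA in auto)
  qed
  have "(\<lambda>n. \<integral>x. (?A (t K) n x - ?E (t K) x)\<^sup>2 \<partial>M) \<longlonglongrightarrow> (\<integral>x. 0 \<partial>M)"
  proof (rule integral_dominated_convergence)
    show "integrable M (\<lambda>x. (2 * real K)\<^sup>2)" by simp
    show "AE x in M. norm ((?A (t K) n x - ?E (t K) x)\<^sup>2) \<le> (2 * real K)\<^sup>2" for n
      using tE
    proof eventually_elim
      case (elim x)
      have "\<bar>?A (t K) n x - ?E (t K) x\<bar> \<le> \<bar>2 * real K\<bar>" using elim tA[of x n] by linarith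
      from abs_le_square_iff[THEN iffD1, OF this] show ?case by simp
    qed
    show "AE x in M. (\<lambda>n. (?A (t K) n x - ?E (t K) x)\<^sup>2) \<longlonglongrightarrow> 0"
      using tlim
    proof eventually_elim
      case (elim x)
      show ?case using tendsto_power[OF tendsto_diff[OF elim tendsto_const[of "?E (t K) x"]], of 2] by simp
    qed
  qed measurable
  then have ev: "\<forall>\<^sub>F n in sequentially. (\<integral>x. (?A (t K) n x - ?E (t K) x)\<^sup>2 \<partial>M) < r / 9"
    using r by (intro order_tendstoD) auto
  have bound: "norm ((\<integral>x. (?A f n x - ?E f x)\<^sup>2 \<partial>M) - 0)
      \<le> 3 * (\<integral>x. (g x)\<^sup>2 \<partial>M) + 3 * (\<integral>x. (?A (t K) n x - ?E (t K) x)\<^sup>2 \<partial>M) + 3 * (\<integral>x. (g x)\<^sup>2 \<partial>M)" for n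
  proof -
    have i1: "integrable M (\<lambda>x. (?A h n x)\<^sup>2)" "integrable M (\<lambda>x. (?E h x)\<^sup>2)" "?A h n \<in> borel_measurable M"
      if "h \<in> borel_measurable M" "integrable M (\<lambda>x. (h x)\<^sup>2)" for h
      using integral_average_square_le(1)[OF that, where s = s and n = n] integral_cond_exp_square_le(1)[OF that]
        measurable_funpow_apply[OF that(1)] by auto
    have i2: "integrable M (\<lambda>x. (?A h n x - ?E h x)\<^sup>2)"
      if "h \<in> borel_measurable M" "integrable M (\<lambda>x. (h x)\<^sup>2)" for h
      using i1[OF that] by (intro integrable_diff_square) auto
    have "AE x in M. ?E (\<lambda>x. f x - t K x) x = ?E f x - ?E (t K) x"
      by (rule inv.real_cond_exp_diff) (use square_integrable_imp_integrable f f2 tm t2 in blast)+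
    then have Eg: "AE x in M. ?E g x = ?E f x - ?E (t K) x" by (simp add: g_def[abs_def])
    have "(\<integral>x. (?A f n x - ?E f x)\<^sup>2 \<partial>M)
        \<le> (\<integral>x. 3 * (?A g n x)\<^sup>2 + 3 * (?A (t K) n x - ?E (t K) x)\<^sup>2 + 3 * (?E g x)\<^sup>2 \<partial>M)"
    proof (rule integral_mono_AE)
      show "AE x in M. (?A f n x - ?E f x)\<^sup>2
          \<le> 3 * (?A g n x)\<^sup>2 + 3 * (?A (t K) n x - ?E (t K) x)\<^sup>2 + 3 * (?E g x)\<^sup>2"
        using Eg
      proof eventually_elim
        case (elim x)
        have "?A f n x = ?A g n x + ?A (t K) n x"
          by (simp add: g_def sum_subtractf diff_divide_distrib)
        then have e: "?A f n x - ?E f x = ?A g n x + (?A (t K) n x - ?E (t K) x) - ?E g x"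
          using elim by simp
        have "(u + v - z)\<^sup>2 \<le> 3 * u\<^sup>2 + 3 * v\<^sup>2 + 3 * z\<^sup>2" for u v z :: real
        proof -
          have "0 \<le> (u - v)\<^sup>2 + (u + z)\<^sup>2 + (v + z)\<^sup>2" by simp
          then show ?thesis by (simp add: power2_eq_square algebra_simps)
        qed
        then show ?case unfolding e .
      qed
      show "integrable M (\<lambda>x. 3 * (?A g n x)\<^sup>2 + 3 * (?A (t K) n x - ?E (t K) x)\<^sup>2 + 3 * (?E g x)\<^sup>2)"
        by (intro Bochner_Integration.integrable_add integrable_mult_right i1 i2 gm g2 tm t2)
    qed (rule i2[OF f f2])
    also have "\<dots> = 3 * (\<integral>x. (?A g n x)\<^sup>2 \<partial>M) + 3 * (\<integral>x. (?A (t K) n x - ?E (t K) x)\<^sup>2 \<partial>M) + 3 * (\<integral>x. (?E g x)\<^sup>2 \<partial>M)"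
      using i1[OF gm g2] i2[OF tm t2] by simp
    also have "\<dots> \<le> 3 * (\<integral>x. (g x)\<^sup>2 \<partial>M) + 3 * (\<integral>x. (?A (t K) n x - ?E (t K) x)\<^sup>2 \<partial>M) + 3 * (\<integral>x. (g x)\<^sup>2 \<partial>M)"
      by (intro add_mono mult_left_mono integral_average_square_le(2) integral_cond_exp_square_le(2) gm g2 order_refl) auto
    finally show ?thesis by simp
  qed
  have "\<forall>\<^sub>F n in sequentially. norm ((\<integral>x. (?A f n x - ?E f x)\<^sup>2 \<partial>M) - 0) < r"
    using ev
  proof eventually_elim
    case (elim n)
    then show ?case using bound[of n] K unfolding g_def by linarith
  qed
  then show "\<exists>no. \<forall>n\<ge>no. norm ((\<integral>x. (?A f n x - ?E f x)\<^sup>2 \<partial>M) - 0) < r"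
    by (simp add: eventually_sequentially)
qed

end

section \<open>From real to complex functions\<close>

lemma Re_ergodic_average: "Re (ergodic_average T s f n x) = (\<Sum>j<n. Re (f ((T ^^ s j) x))) / n"
  and Im_ergodic_average: "Im (ergodic_average T s f n x) = (\<Sum>j<n. Im (f ((T ^^ s j) x))) / n"
  by (simp_all add: ergodic_average_def Re_divide_of_nat Im_divide_of_nat)

lemma in_Lp_2:
  assumes "in_Lp M 2 f"
  shows "f \<in> borel_measurable M" "integrable M (\<lambda>x. (Re (f x))\<^sup>2)" "integrable M (\<lambda>x. (Im (f x))\<^sup>2)"
proof -
  show [measurable]: "f \<in> borel_measurable M" using assms by (simp add: in_Lp_def)
  have n: "norm (f x) powr 2 = (Re (f x))\<^sup>2 + (Im (f x))\<^sup>2" for x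
    by (simp add: cmod_power2[symmetric] powr_numeral)
  have i: "integrable M (\<lambda>x. (Re (f x))\<^sup>2 + (Im (f x))\<^sup>2)"
    using assms unfolding in_Lp_def n by simp
  show "integrable M (\<lambda>x. (Re (f x))\<^sup>2)" "integrable M (\<lambda>x. (Im (f x))\<^sup>2)"
    by (rule Bochner_Integration.integrable_bound[OF i]; simp)+
qed

context measure_preserving_system
begin

text \<open>Real and imaginary parts are treated separately; the squared complex error is the sum of
  the two squared real errors.\<close>

lemma ergodic_averages_of_real:
  fixes f :: "'x \<Rightarrow> complex" and s :: "nat \<Rightarrow> nat"
  assumes AE: "\<And>g :: 'x \<Rightarrow> real. g \<in> borel_measurable M \<Longrightarrow> integrable M (\<lambda>x. (g x)\<^sup>2) \<Longrightarrow>
      AE x in M. (\<lambda>n. (\<Sum>j<n. g ((T ^^ s j) x)) / n) \<longlonglongrightarrow> real_cond_exp M (invariant_algebra M T) g x"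
    and f: "in_Lp M 2 f"
  shows "AE x in M. convergent (\<lambda>n. ergodic_average T s f n x)"
    and "(\<lambda>n. \<integral>\<^sup>+x. ennreal ((norm (ergodic_average T s f n x
             - complex_cond_exp M (invariant_algebra M T) f x))\<^sup>2) \<partial>M) \<longlonglongrightarrow> 0"
proof -
  note [measurable] = in_Lp_2(1)[OF f]
  let ?E = "real_cond_exp M (invariant_algebra M T)"
  let ?re = "\<lambda>x. Re (f x)" and ?im = "\<lambda>x. Im (f x)"
  have re: "?re \<in> borel_measurable M" "integrable M (\<lambda>x. (?re x)\<^sup>2)"
    and im: "?im \<in> borel_measurable M" "integrable M (\<lambda>x. (?im x)\<^sup>2)"
    using in_Lp_2[OF f] by auto
  show "AE x in M. convergent (\<lambda>n. ergodic_average T s f n x)"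
    using AE[OF re] AE[OF im]
  proof eventually_elim
    case (elim x)
    have "(\<lambda>n. Complex (Re (ergodic_average T s f n x)) (Im (ergodic_average T s f n x)))
        \<longlonglongrightarrow> Complex (?E ?re x) (?E ?im x)"
      unfolding Re_ergodic_average Im_ergodic_average by (rule tendsto_Complex[OF elim])
    then show ?case by (auto intro: convergentI)
  qed
  let ?D = "\<lambda>g n x. ((\<Sum>j<n. g ((T ^^ s j) x)) / real n - ?E g x)\<^sup>2"
  have int: "integrable M (?D g n)" if "g \<in> borel_measurable M" "integrable M (\<lambda>x. (g x)\<^sup>2)" for g n
    using integral_average_square_le(1)[OF that, where s = s and n = n] integral_cond_exp_square_le(1)[OF that]
      measurable_funpow_apply[OF that(1)] by (intro integrable_diff_square) auto
  have eq: "(norm (ergodic_average T s f n x - complex_cond_exp M (invariant_algebra M T) f x))\<^sup>2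
      = ?D ?re n x + ?D ?im n x" for n x
    by (simp add: cmod_power2 Re_ergodic_average Im_ergodic_average complex_cond_exp_def)
  have "(\<integral>\<^sup>+x. ennreal ((norm (ergodic_average T s f n x
        - complex_cond_exp M (invariant_algebra M T) f x))\<^sup>2) \<partial>M)
      = ennreal ((\<integral>x. ?D ?re n x \<partial>M) + (\<integral>x. ?D ?im n x \<partial>M))" for n
    unfolding eq using int[OF re, of n] int[OF im, of n] by (subst nn_integral_eq_integral) auto
  moreover have "(\<lambda>n. ennreal ((\<integral>x. ?D ?re n x \<partial>M) + (\<integral>x. ?D ?im n x \<partial>M))) \<longlonglongrightarrow> ennreal (0 + 0)"
    by (intro tendsto_ennrealI tendsto_add tendsto_integral_square_of_AE_tendsto[OF AE] re im)
  ultimately show "(\<lambda>n. \<integral>\<^sup>+x. ennreal ((norm (ergodic_average T s f n x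
             - complex_cond_exp M (invariant_algebra M T) f x))\<^sup>2) \<partial>M) \<longlonglongrightarrow> 0"
    by simp
qed

end

theorem (in sparse_set) good_and_ergodic: "good_and_ergodic_set TYPE('x) S"
  unfolding good_and_ergodic_set_def pointwise_universally_good_def ergodic_sequence_def
proof (intro conjI allI impI)
  show "infinite S" by (rule infinite_S)
next
  fix M :: "'x measure" and T f assume "measure_preserving_system M T \<and> in_Lp M 2 f"
  then show "AE x in M. convergent (\<lambda>N. ergodic_average T (enumerate S) f N x)"
    using measure_preserving_system.ergodic_averages_of_real(1) AE_tendsto_average_enumerate by blast
next
  fix M :: "'x measure" and T f assume "measure_preserving_system M T \<and> in_Lp M 2 f"
  then show "(\<lambda>N. \<integral>\<^sup>+x. ennreal ((norm (ergodic_average T (enumerate S) f N x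
             - complex_cond_exp M (invariant_algebra M T) f x))\<^sup>2) \<partial>M) \<longlonglongrightarrow> 0"
    using measure_preserving_system.ergodic_averages_of_real(2) AE_tendsto_average_enumerate by blast
qed

section \<open>The shrinking target set\<close>

context power_digit_process
begin

lemma strict_mono_scale: "strict_mono scale"
proof (rule strict_monoI)
  fix k l :: nat assume "k < l"
  moreover have "0 < nat \<lceil>2 / gap\<rceil>" using gap by simp
  ultimately show "scale k < scale l" unfolding scale_def by (intro power_strict_mono) auto
qed

lemma total_at_top: "filterlim total at_top sequentially"
proof (rule filterlim_at_top_mono)
  show "filterlim (\<lambda>n. real n powr (1 - a) / 2) at_top sequentially"
    using a_half by real_asymp
  show "\<forall>\<^sub>F n in sequentially. real n powr (1 - a) / 2 \<le> total n"
    using eventually_ge_at_top[of 2]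
    by eventually_elim (use sum_powr_ge[OF a0] in \<open>simp add: total_def wt_def\<close>)
qed

text \<open>Weights between \<open>n\<close> and \<open>m\<close> are at most
  \<open>n powr (- a)\<close>, while \<open>total n\<close> is at least
  \<open>n powr (1 - a) / 2\<close>; this half produces the factor 2.\<close>

lemma total_diff_le:
  assumes "2 \<le> n" "n \<le> m"
  shows "total m / total n - 1 \<le> 2 * (real m / real n - 1)"
proof -
  have lower: "real n powr (1 - a) / 2 \<le> total n"
    using sum_powr_ge[OF a0 assms(1)] by (simp add: total_def wt_def)
  have pos: "0 < real n powr (1 - a) / 2" using assms by simp
  have tn: "0 < total n" using lower pos by linarith
  have eq: "total m = total n + (\<Sum>i\<in>{n..<m}. wt i)"
    unfolding total_def using assms by (simp add: lessThan_atLeast0 sum.atLeastLessThan_concat)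
  have "(\<Sum>i\<in>{n..<m}. wt i) \<le> (\<Sum>i\<in>{n..<m}. wt n)"
    using assms by (intro sum_mono wt_antimono) auto
  also have "\<dots> = (real m - real n) * real n powr (- a)" using assms by (simp add: wt_def of_nat_diff)
  finally have upper: "(\<Sum>i\<in>{n..<m}. wt i) \<le> (real m - real n) * real n powr (- a)" .
  have "total m / total n - 1 = (\<Sum>i\<in>{n..<m}. wt i) / total n"
    using eq tn by (simp add: add_divide_distrib)
  also have "\<dots> \<le> ((real m - real n) * real n powr (- a)) / (real n powr (1 - a) / 2)"
    using upper lower pos assms by (intro frac_le mult_nonneg_nonneg) auto
  also have "\<dots> = 2 * (real m / real n - 1)"
    using assms by (simp add: powr_diff powr_minus field_simps)
  finally show ?thesis .
qed

text \<open>\<open>total_diff_le\<close> reduces this to the ratio of consecutive scales, a fixed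
  power of \<open>(k + 2) / (k + 1)\<close>.\<close>

lemma total_ratio: "(\<lambda>k. total (scale (Suc k)) / total (scale k)) \<longlonglongrightarrow> 1"
proof -
  let ?L = "nat \<lceil>2 / gap\<rceil>"
  have ev: "\<forall>\<^sub>F k in sequentially. 2 \<le> scale k"
    using filterlim_subseq[OF strict_mono_scale] by (simp add: filterlim_at_top)
  have "(\<lambda>k. real (Suc (Suc k)) / real (Suc k)) \<longlonglongrightarrow> 1" by real_asymp
  then have "(\<lambda>k. 1 + 2 * ((real (Suc (Suc k)) / real (Suc k)) ^ ?L - 1)) \<longlonglongrightarrow> 1 + 2 * (1 ^ ?L - 1)"
    by (intro tendsto_intros)
  moreover have "real (scale (Suc k)) / real (scale k) = (real (Suc (Suc k)) / real (Suc k)) ^ ?L" for k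
    by (simp only: scale_def of_nat_power power_divide)
  moreover have "1 + 2 * (1 ^ ?L - 1) = (1 :: real)" by simp
  ultimately have lim: "(\<lambda>k. 1 + 2 * (real (scale (Suc k)) / real (scale k) - 1)) \<longlonglongrightarrow> 1"
    by (simp only:)
  show ?thesis
  proof (rule tendsto_sandwich[OF _ _ tendsto_const lim])
    show "\<forall>\<^sub>F k in sequentially. 1 \<le> total (scale (Suc k)) / total (scale k)"
      using ev
    proof eventually_elim
      case (elim k)
      have "0 < real (scale k) powr (1 - a) / 2" using elim by simp
      also have "\<dots> \<le> total (scale k)"
        using sum_powr_ge[OF a0 elim] by (simp add: total_def wt_def)
      finally have "0 < total (scale k)" .
      moreover have "total (scale k) \<le> total (scale (Suc k))"
        unfolding total_def using strict_mono_scale wt_nonneg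
        by (intro sum_mono2) (auto simp: strict_mono_less_eq)
      ultimately show ?case by simp
    qed
    show "\<forall>\<^sub>F k in sequentially. total (scale (Suc k)) / total (scale k)
        \<le> 1 + 2 * (real (scale (Suc k)) / real (scale k) - 1)"
      using ev
    proof eventually_elim
      case (elim k)
      then show ?case
        using total_diff_le[OF elim, of "scale (Suc k)"] strict_mono_scale by (simp add: strict_mono_less_eq)
    qed
  qed
qed

text \<open>For irrational \<open>y\<close> no fractional part \<open>frac (p ^ n * y)\<close> is 0,
  so the open lower end of the target excludes nothing and membership is the event whose centred
  indicator is \<open>dev n y\<close>.\<close>

lemma sparse_set_shrinking_target:
  assumes sum: "summable (\<lambda>k. correlation_sum (\<lambda>n. dev n y) (scale k) / (total (scale k))\<^sup>2)"
    and y: "y \<notin> \<rat>"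
  shows "sparse_set wt (shrinking_target_set a p y) scale"
proof -
  have frac: "0 < frac (real p ^ n * y)" for n
  proof -
    have "real p ^ n * y \<notin> \<int>"
    proof
      assume "real p ^ n * y \<in> \<int>"
      then have "real p ^ n * y / real p ^ n \<in> \<rat>"
        using Ints_subset_Rats by (intro Rats_divide) auto
      then show False using y p2 by simp
    qed
    then show ?thesis by (simp add: frac_gt_0_iff)
  qed
  \<comment> \<open>At \<open>n = 0\<close> both sides are false, because \<open>wt 0 = 0\<close>
    and fractional parts are nonnegative.\<close>
  have "n \<in> shrinking_target_set a p y \<longleftrightarrow> frac (real p ^ n * y) < wt n" for n
    using frac[of n] frac_ge_0[of y]
    by (cases "n = 0") (auto simp: shrinking_target_set_def wt_def not_less)
  then have "of_bool (n \<in> shrinking_target_set a p y) - wt n = dev n y" for n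
    by (simp add: dev_def)
  then show ?thesis
    using sum total_at_top total_ratio strict_mono_scale wt_nonneg wt_antimono
    by unfold_locales (auto simp: total_def[abs_def] wt_def[of 0])
qed

lemma AE_good_and_ergodic:
  "AE y in lebesgue_on {0..1}. good_and_ergodic_set TYPE('x) (shrinking_target_set a p y)"
proof -
  have "AE y in lborel. y \<in> {0..<1} \<longrightarrow>
      summable (\<lambda>k. correlation_sum (\<lambda>n. dev n y) (scale k) / (total (scale k))\<^sup>2)"
    using AE_summable_correlation_sum unfolding unit_interval_def by (subst (asm) AE_restrict_space_iff) auto
  moreover have "AE y in lborel. y \<notin> (\<rat> :: real set)"
    by (rule AE_not_in) (simp add: countable_imp_null_set_lborel countable_rat)
  ultimately have "AE y in lborel. y \<in> {0..1} \<longrightarrow>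
      good_and_ergodic_set TYPE('x) (shrinking_target_set a p y)"
  proof eventually_elim
    case (elim y)
    show ?case
    proof
      assume "y \<in> {0..1}"
      \<comment> \<open>The endpoint missing from \<open>unit_interval\<close> is rational and so
        already excluded.\<close>
      moreover have "y \<noteq> 1" using elim(2) by auto
      ultimately have "y \<in> {0..<1}" by auto
      then show "good_and_ergodic_set TYPE('x) (shrinking_target_set a p y)"
        using sparse_set.good_and_ergodic[OF sparse_set_shrinking_target] elim by blast
    qed
  qed
  then have "AE y in lebesgue. y \<in> {0..1} \<longrightarrow>
      good_and_ergodic_set TYPE('x) (shrinking_target_set a p y)"
    by (rule AE_completion)
  then show ?thesis by (subst AE_restrict_space_iff) auto
qed

end

section \<open>Transfer to systems on an arbitrary type\<close>

definition orbit_map :: "('x \<Rightarrow> 'x) \<Rightarrow> ('x \<Rightarrow> complex) \<Rightarrow> 'x \<Rightarrow> nat \<Rightarrow> complex" where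
  "orbit_map T f x n = f ((T ^^ n) x)"

definition shift :: "(nat \<Rightarrow> complex) \<Rightarrow> nat \<Rightarrow> complex" where
  "shift u n = u (Suc n)"

text \<open>The law of the stationary process \<open>f x, f (T x), f (T (T x)), ...\<close>.\<close>

definition orbit_measure :: "'x measure \<Rightarrow> ('x \<Rightarrow> 'x) \<Rightarrow> ('x \<Rightarrow> complex) \<Rightarrow> (nat \<Rightarrow> complex) measure" where
  "orbit_measure M T f = distr M (Pi\<^sub>M UNIV (\<lambda>_. borel)) (orbit_map T f)"

lemma funpow_shift: "(shift ^^ n) (orbit_map T f x) = orbit_map T f ((T ^^ n) x)"
proof (induction n)
  case (Suc n)
  have "shift (orbit_map T f z) = orbit_map T f (T z)" for z
    by (simp add: fun_eq_iff shift_def orbit_map_def funpow_swap1)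
  then show ?case using Suc by simp
qed simp

lemma ergodic_average_orbit_map:
  "ergodic_average shift s (\<lambda>u. u 0) n (orbit_map T f x) = ergodic_average T s f n x"
  by (simp add: ergodic_average_def funpow_shift) (simp add: orbit_map_def)

context measure_preserving_system
begin

context
  fixes f :: "'x \<Rightarrow> complex"
  assumes f: "f \<in> borel_measurable M"
begin

lemma measurable_orbit_map [measurable]: "orbit_map T f \<in> measurable M (Pi\<^sub>M UNIV (\<lambda>_. borel))"
  by (rule measurable_PiM_single') (auto simp: orbit_map_def measurable_funpow_apply[OF f])

lemma measurable_shift: "shift \<in> measurable (Pi\<^sub>M UNIV (\<lambda>_. borel)) (Pi\<^sub>M UNIV (\<lambda>_. borel))"
  by (rule measurable_PiM_single') (auto simp: shift_def)

text \<open>The orbit map intertwines \<open>T\<close> with the shift, so invariance of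
  \<open>M\<close> passes to its image.\<close>

lemma measure_preserving_system_orbit: "measure_preserving_system (orbit_measure M T f) shift"
proof -
  interpret O: prob_space "orbit_measure M T f"
    unfolding orbit_measure_def by (rule prob_space_distr[OF measurable_orbit_map])
  show ?thesis
  proof
    show "shift \<in> measurable (orbit_measure M T f) (orbit_measure M T f)"
      using measurable_shift by (simp add: orbit_measure_def)
    fix A assume "A \<in> sets (orbit_measure M T f)"
    then have A: "A \<in> sets (Pi\<^sub>M UNIV (\<lambda>_. borel))" by (simp add: orbit_measure_def)
    let ?P = "Pi\<^sub>M UNIV (\<lambda>_. borel) :: (nat \<Rightarrow> complex) measure"
    have sA: "shift -` A \<inter> space ?P \<in> sets ?P" by (rule measurable_sets[OF measurable_shift A])
    have "orbit_map T f -` (shift -` A \<inter> space ?P) \<inter> space M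
        = T -` (orbit_map T f -` A \<inter> space M) \<inter> space M"
      using funpow_shift[of 1 T f] measurable_space[OF measurable_orbit_map] measurable_space[OF measurable_map]
      by auto
    then show "emeasure (orbit_measure M T f) (shift -` A \<inter> space (orbit_measure M T f))
        = emeasure (orbit_measure M T f) A"
      using preserves_measure[OF measurable_sets[OF measurable_orbit_map A]] sA A
      by (simp add: orbit_measure_def emeasure_distr)
  qed
qed

text \<open>By the pointwise ergodic theorem both sides are the limit of the same averages.\<close>

lemma AE_cond_exp_orbit_measure:
  fixes g :: "complex \<Rightarrow> real"
  assumes g[measurable]: "g \<in> borel_measurable borel" and int: "integrable M (\<lambda>x. g (f x))"
  shows "AE x in M. real_cond_exp (orbit_measure M T f) (invariant_algebra (orbit_measure M T f) shift)
      (\<lambda>u. g (u 0)) (orbit_map T f x) = real_cond_exp M (invariant_algebra M T) (\<lambda>x. g (f x)) x"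
proof -
  interpret O: measure_preserving_system "orbit_measure M T f" shift
    by (rule measure_preserving_system_orbit)
  have "integrable (orbit_measure M T f) (\<lambda>u. g (u 0))"
    unfolding orbit_measure_def using int by (subst integrable_distr_eq) (auto simp: orbit_map_def)
  from AE_distrD[OF measurable_orbit_map O.AE_Birkhoff[OF this, unfolded orbit_measure_def]]
  have "AE x in M. (\<lambda>n. (\<Sum>i<n. g (f ((T ^^ i) x))) / n)
      \<longlonglongrightarrow> real_cond_exp (orbit_measure M T f) (invariant_algebra (orbit_measure M T f) shift)
        (\<lambda>u. g (u 0)) (orbit_map T f x)"
    unfolding funpow_shift orbit_measure_def[symmetric] by (simp add: orbit_map_def[of T f _ 0])
  then show ?thesis using AE_Birkhoff[OF int]
    by eventually_elim (rule LIMSEQ_unique)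
qed

end

end

text \<open>In the orbit system \<open>f\<close> becomes the zeroth coordinate. Its averages pull
  back to those of \<open>f\<close> at every point and its conditional expectation at almost every
  point, so both convergence statements pass from the image measure to \<open>M\<close>.\<close>

lemma good_and_ergodic_set_transfer:
  assumes "good_and_ergodic_set TYPE(nat \<Rightarrow> complex) S"
  shows "good_and_ergodic_set TYPE('x) S"
proof -
  let ?s = "enumerate S"
  have inf: "infinite S"
    and good: "\<And>M T f. measure_preserving_system M T \<Longrightarrow> in_Lp M 2 f \<Longrightarrow>
      AE u in M. convergent (\<lambda>n. ergodic_average T ?s f n (u :: nat \<Rightarrow> complex))"
    and erg: "\<And>M T f. measure_preserving_system M T \<Longrightarrow> in_Lp M 2 f \<Longrightarrow>
      (\<lambda>n. \<integral>\<^sup>+u. ennreal ((norm (ergodic_average T ?s f n (u :: nat \<Rightarrow> complex)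
         - complex_cond_exp M (invariant_algebra M T) f u))\<^sup>2) \<partial>M) \<longlonglongrightarrow> 0"
    using assms unfolding good_and_ergodic_set_def pointwise_universally_good_def ergodic_sequence_def
    by auto
  have "(AE x in M. convergent (\<lambda>n. ergodic_average T ?s f n x)) \<and>
      (\<lambda>n. \<integral>\<^sup>+x. ennreal ((norm (ergodic_average T ?s f n x
         - complex_cond_exp M (invariant_algebra M T) f x))\<^sup>2) \<partial>M) \<longlonglongrightarrow> 0"
    if MT: "measure_preserving_system M T" and f: "in_Lp M 2 f" for M :: "'x measure" and T f
  proof -
    interpret measure_preserving_system M T by (rule MT)
    note fm[measurable] = in_Lp_2(1)[OF f]
    let ?P = "Pi\<^sub>M UNIV (\<lambda>_. borel) :: (nat \<Rightarrow> complex) measure"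
    let ?O = "orbit_measure M T f" and ?\<pi> = "orbit_map T f" and ?f0 = "\<lambda>u :: nat \<Rightarrow> complex. u 0"
    note \<pi>[measurable] = measurable_orbit_map[OF fm]
    interpret O: measure_preserving_system ?O shift by (rule measure_preserving_system_orbit[OF fm])
    have f0: "in_Lp ?O 2 ?f0"
      using f unfolding in_Lp_def orbit_measure_def by (auto simp: integrable_distr_eq orbit_map_def)
    have re: "integrable M (\<lambda>x. Re (f x))" "integrable M (\<lambda>x. Im (f x))"
      using in_Lp_2[OF f] by (auto intro: square_integrable_imp_integrable)
    have ce: "AE x in M. complex_cond_exp ?O (invariant_algebra ?O shift) ?f0 (?\<pi> x)
        = complex_cond_exp M (invariant_algebra M T) f x"
      using AE_cond_exp_orbit_measure[OF fm borel_measurable_Re re(1)]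
        AE_cond_exp_orbit_measure[OF fm borel_measurable_Im re(2)]
      by eventually_elim (simp add: complex_cond_exp_def)
    have "AE x in M. convergent (\<lambda>n. ergodic_average shift ?s ?f0 n (?\<pi> x))"
      using AE_distrD[OF \<pi>] good[OF O.measure_preserving_system_axioms f0] unfolding orbit_measure_def by blast
    moreover have "(\<integral>\<^sup>+u. ennreal ((norm (ergodic_average shift ?s ?f0 n u
          - complex_cond_exp ?O (invariant_algebra ?O shift) ?f0 u))\<^sup>2) \<partial>?O)
        = (\<integral>\<^sup>+x. ennreal ((norm (ergodic_average T ?s f n x
          - complex_cond_exp M (invariant_algebra M T) f x))\<^sup>2) \<partial>M)" for n
    proof -
      have m1: "ergodic_average shift ?s ?f0 n \<in> borel_measurable ?O"
        unfolding ergodic_average_def using O.measurable_funpow_apply[OF in_Lp_2(1)[OF f0]] by measurable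
      have m2: "complex_cond_exp ?O (invariant_algebra ?O shift) ?f0 \<in> borel_measurable ?O"
        unfolding complex_cond_exp_def Complex_eq by measurable
      have "(\<integral>\<^sup>+u. ennreal ((norm (ergodic_average shift ?s ?f0 n u
          - complex_cond_exp ?O (invariant_algebra ?O shift) ?f0 u))\<^sup>2) \<partial>?O)
        = (\<integral>\<^sup>+x. ennreal ((norm (ergodic_average shift ?s ?f0 n (?\<pi> x)
          - complex_cond_exp ?O (invariant_algebra ?O shift) ?f0 (?\<pi> x)))\<^sup>2) \<partial>M)"
        using m1 m2 \<pi>
        by (subst (1) orbit_measure_def, subst nn_integral_distr) (auto simp: orbit_measure_def)
      also have "\<dots> = (\<integral>\<^sup>+x. ennreal ((norm (ergodic_average T ?s f n x
          - complex_cond_exp M (invariant_algebra M T) f x))\<^sup>2) \<partial>M)"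
        using ce by (intro nn_integral_cong_AE) (auto simp: ergodic_average_orbit_map)
      finally show ?thesis .
    qed
    ultimately show ?thesis
      using erg[OF O.measure_preserving_system_axioms f0] by (simp add: ergodic_average_orbit_map)
  qed
  then show ?thesis
    using inf unfolding good_and_ergodic_set_def pointwise_universally_good_def ergodic_sequence_def by blast
qed

theorem corollary1:
  fixes a :: real and p :: nat
  assumes "0 < a" and "a < 1 / 2" and "2 \<le> p"
  shows "(AE y in lebesgue_on {0..1}.
            good_and_ergodic_set TYPE(nat \<Rightarrow> complex) (shrinking_target_set a p y))
       \<and> (\<forall>y\<in>{0..1}.
            good_and_ergodic_set TYPE(nat \<Rightarrow> complex) (shrinking_target_set a p y) \<longrightarrow>
            good_and_ergodic_set TYPE('x) (shrinking_target_set a p y))"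
proof -
  interpret power_digit_process p a
    using assms by unfold_locales
  show ?thesis
    using AE_good_and_ergodic good_and_ergodic_set_transfer by blast
qed

end
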